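(* Let $d\ge1$ and let $0<\beta<\alpha\le1$. Let $u_0\in L^2(\mathbb{R}^d)$ be such that its Fourier transform $\hat u_0$ is a continuously differentiable compactly supported function on $\mathbb{R}^d$, and let $0\le\Lambda_-\le\Lambda_+<\infty$ be such that $$\operatorname{supp}(\hat u_0)\subset\{\xi\in\mathbb{R}^d:\ \Lambda_-\le|\xi|\le\Lambda_+\}.$$ Let $u$ be the solution of the time-fractional Schrödinger equation $i^\beta\partial_t^\alpha u=-\Delta u$ in $\mathbb{R}^d\times(0,\infty)$ with $u(\cdot,0)=u_0$. Then the mean square displacement $D_2(u_0,t)$ of $u$ satisfies, as $t\to\infty$, $$\frac{4}{\alpha^2}\,e^{2\cos\left(\frac{\pi\beta}{2\alpha}\right)\Lambda_-^{2/\alpha}t}\,t\left(\left\||\xi|^{\frac{2-\alpha}{\alpha}}\hat u_0\right\|^2+O(t^{-1})\right)\le D_2(u_0,t)\le\frac{4}{\alpha^2}\,e^{2\cos\left(\frac{\pi\beta}{2\alpha}\right)\Lambda_+^{2/\alpha}t}\,t\left(\left\||\xi|^{\frac{2-\alpha}{\alpha}}\hat u_0\right\|^2+O(t^{-1})\right).$$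
   Context: $\|\cdot\|$ is the norm of $L^2(\mathbb{R}^d)$ or $L^2(\mathbb{R}^d)^d$ (in the variable $\xi$ for functions of $\xi$). Fourier transform: $\hat v(\xi)=(\mathcal{F}v)(\xi)=(2\pi)^{-d/2}\int_{\mathbb{R}^d}e^{-ix\cdot\xi}v(x)\,dx$. Powers of complex numbers are principal, so $i^\beta=e^{i\pi\beta/2}$ and $(-i)^\beta=e^{-i\pi\beta/2}$. For $\alpha\in(0,1)$, $\partial_t^\alpha$ is the Caputo derivative $\partial_t^\alpha u(t)=\frac{1}{\Gamma(1-\alpha)}\int_0^t\frac{u'(s)}{(t-s)^\alpha}\,ds$; for $\alpha=1$ it is the usual derivative $\partial_t$. A solution of the initial-value problem is a function $u\in L^1_{\rm loc}((0,\infty),H^2(\mathbb{R}^d))\cap W^{1,1}_{\rm loc}((0,\infty),L^2(\mathbb{R}^d))$ satisfying the equation for a.e. $(x,t)\in\mathbb{R}^d\times(0,\infty)$ and $\lim_{t\downarrow0}\|u(\cdot,t)-u_0\|=0$. The solution considered is given by $\hat u(\xi,t)=E_{\alpha,1}\big((-i)^\beta|\xi|^2t^\alpha\big)\hat u_0(\xi)$, where $E_{\alpha,\gamma}(z)=\sum_{n\ge0}\frac{z^n}{\Gamma(\alpha n+\gamma)}$ is the Mittag-Leffler function and $\hat u(\cdot,t)$ is the Fourier transform in $x$. The mean square displacement is $D_2(u_0,t):=\|\nabla_\xi\hat u(\cdot,t)\|^2$ (which equals $\int_{\mathbb{R}^d}|x|^2|u(x,t)|^2\,dx$ when this makes sense).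 *)

theory Defs
  imports "HOL-Analysis.Analysis" "HOL-Library.Landau_Symbols"
begin

section \<open>Square-integrable functions and the Fourier transform\<close>

definition square_integrable :: "('a::euclidean_space \<Rightarrow> 'b::real_normed_vector) \<Rightarrow> bool" where
  "square_integrable f \<longleftrightarrow>
     f \<in> borel_measurable lebesgue \<and> integrable lebesgue (\<lambda>x. (norm (f x))\<^sup>2)"

text \<open>The codomain may be \<open>complex^'d\<close>, whose norm is the Euclidean one; this gives
  the norm of \<open>L\<^sup>2(\<real>\<^sup>d)\<^sup>d\<close>.\<close>

definition L2_norm :: "('a::euclidean_space \<Rightarrow> 'b::real_normed_vector) \<Rightarrow> real" where
  "L2_norm f = sqrt (\<integral>x. (norm (f x))\<^sup>2 \<partial>lebesgue)"

definition fourier_integral :: "(real^'d \<Rightarrow> complex) \<Rightarrow> real^'d \<Rightarrow> complex" where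
  "fourier_integral v \<xi> =
     of_real ((2 * pi) powr (- real CARD('d) / 2)) *
     (\<integral>x. exp (- (\<i> * of_real (x \<bullet> \<xi>))) * v x \<partial>lebesgue)"

text \<open>On \<open>L\<^sup>2\<close> the Fourier integral need not converge; as usual the transform is the
  \<open>L\<^sup>2\<close>-limit of the Fourier integrals of the truncations of \<open>v\<close> to balls. It is determined
  only up to null sets, hence a relation. The nonnegative integral is used so that
  a difference outside \<open>L\<^sup>2\<close> has infinite (not zero) norm.\<close>

definition has_fourier_transform :: "(real^'d \<Rightarrow> complex) \<Rightarrow> (real^'d \<Rightarrow> complex) \<Rightarrow> bool" where
  "has_fourier_transform v w \<longleftrightarrow>
     square_integrable v \<and> square_integrable w \<and>
     ((\<lambda>R. \<integral>\<^sup>+\<xi>. ennreal ((norm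
          (fourier_integral (\<lambda>x. indicator (cball 0 R) x *\<^sub>R v x) \<xi> - w \<xi>))\<^sup>2) \<partial>lebesgue)
        \<longlongrightarrow> 0) at_top"


section \<open>Classical and weak derivatives\<close>

definition dir_deriv :: "'a \<Rightarrow> ('a::euclidean_space \<Rightarrow> complex) \<Rightarrow> 'a \<Rightarrow> complex" where
  "dir_deriv b f x = frechet_derivative f (at x) b"

definition gradient :: "(real^'d \<Rightarrow> complex) \<Rightarrow> real^'d \<Rightarrow> complex^'d" where
  "gradient f x = (\<chi> j. dir_deriv (axis j 1) f x)"

fun C_k :: "nat \<Rightarrow> ('a::euclidean_space \<Rightarrow> complex) \<Rightarrow> bool" where
  "C_k 0 f \<longleftrightarrow> continuous_on UNIV f"
| "C_k (Suc k) f \<longleftrightarrow> (\<forall>x. f differentiable (at x)) \<and> (\<forall>b\<in>Basis. C_k k (dir_deriv b f))"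

definition supp :: "('a::topological_space \<Rightarrow> complex) \<Rightarrow> 'a set" where
  "supp f = closure {x. f x \<noteq> 0}"

definition test_function :: "'a::euclidean_space set \<Rightarrow> ('a \<Rightarrow> complex) \<Rightarrow> bool" where
  "test_function U \<phi> \<longleftrightarrow> (\<forall>k. C_k k \<phi>) \<and> compact (supp \<phi>) \<and> supp \<phi> \<subseteq> U"

definition weak_partial ::
  "'a \<Rightarrow> ('a::euclidean_space \<Rightarrow> complex) \<Rightarrow> ('a \<Rightarrow> complex) \<Rightarrow> bool" where
  "weak_partial b v g \<longleftrightarrow>
     (\<forall>\<phi>. test_function UNIV \<phi> \<longrightarrow>
        (\<integral>x. v x * dir_deriv b \<phi> x \<partial>lebesgue) = - (\<integral>x. g x * \<phi> x \<partial>lebesgue))"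


section \<open>Functions of time with values in \<open>L\<^sup>2\<close> and \<open>H\<^sup>2\<close>\<close>

text \<open>Functions are written time first. Bochner measurability of an \<open>L\<^sup>2\<close>-valued function is
  expressed by joint measurability of a representative.\<close>

definition L1loc_L2 :: "(real \<Rightarrow> real^'d \<Rightarrow> complex) \<Rightarrow> bool" where
  "L1loc_L2 f \<longleftrightarrow>
     (\<lambda>(t, x). f t x) \<in> borel_measurable (lebesgue_on ({0<..} \<times> UNIV)) \<and>
     (\<forall>t>0. square_integrable (f t)) \<and>
     (\<forall>a b. 0 < a \<longrightarrow> a < b \<longrightarrow> set_integrable lebesgue {a..b} (\<lambda>t. L2_norm (f t)))"

text \<open>\<open>u \<in> L\<^sup>1\<^sub>l\<^sub>o\<^sub>c((0,\<infinity>), H\<^sup>2)\<close>, with first and second weak space derivatives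
  \<open>D1 b\<close> and \<open>D2 b c\<close>.\<close>

definition L1loc_H2 ::
  "(real \<Rightarrow> real^'d \<Rightarrow> complex) \<Rightarrow>
   (real^'d \<Rightarrow> real \<Rightarrow> real^'d \<Rightarrow> complex) \<Rightarrow>
   (real^'d \<Rightarrow> real^'d \<Rightarrow> real \<Rightarrow> real^'d \<Rightarrow> complex) \<Rightarrow> bool" where
  "L1loc_H2 u D1 D2 \<longleftrightarrow>
     L1loc_L2 u \<and>
     (\<forall>b\<in>Basis. L1loc_L2 (D1 b) \<and>
        (AE t in lebesgue. 0 < t \<longrightarrow> weak_partial b (u t) (D1 b t))) \<and>
     (\<forall>b\<in>Basis. \<forall>c\<in>Basis. L1loc_L2 (D2 b c) \<and>
        (AE t in lebesgue. 0 < t \<longrightarrow> weak_partial c (D1 b t) (D2 b c t)))"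

text \<open>\<open>u \<in> W\<^sup>1\<^sup>,\<^sup>1\<^sub>l\<^sub>o\<^sub>c((0,\<infinity>), L\<^sup>2)\<close> with weak time derivative \<open>ut\<close>. The \<open>L\<^sup>2\<close>-valued
  Bochner integrals over time are evaluated pointwise for almost every \<open>x\<close>.\<close>

definition W11loc_L2 ::
  "(real \<Rightarrow> real^'d \<Rightarrow> complex) \<Rightarrow> (real \<Rightarrow> real^'d \<Rightarrow> complex) \<Rightarrow> bool" where
  "W11loc_L2 u ut \<longleftrightarrow>
     L1loc_L2 u \<and> L1loc_L2 ut \<and>
     (\<forall>\<psi>. test_function {0<..} \<psi> \<longrightarrow>
        (AE x in lebesgue.
           (\<integral>t. u t x * dir_deriv 1 \<psi> t \<partial>lebesgue) = - (\<integral>t. ut t x * \<psi> t \<partial>lebesgue)))"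


section \<open>The time-fractional Schroedinger equation\<close>

text \<open>\<open>has_caputo_derivative \<alpha> v' t y\<close>: the Caputo derivative of order \<open>\<alpha> \<in> (0,1]\<close>, at time \<open>t\<close>, of
  a function with derivative \<open>v'\<close> exists and equals \<open>y\<close>.\<close>

definition has_caputo_derivative :: "real \<Rightarrow> (real \<Rightarrow> complex) \<Rightarrow> real \<Rightarrow> complex \<Rightarrow> bool" where
  "has_caputo_derivative \<alpha> v' t y \<longleftrightarrow>
     (if \<alpha> = 1 then y = v' t
      else set_integrable lebesgue {0<..<t} (\<lambda>s. v' s / of_real ((t - s) powr \<alpha>)) \<and>
           y = (LINT s:{0<..<t}|lebesgue. v' s / of_real ((t - s) powr \<alpha>)) / of_real (Gamma (1 - \<alpha>)))"

definition schroedinger_solution ::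
  "real \<Rightarrow> real \<Rightarrow> (real^'d \<Rightarrow> complex) \<Rightarrow> (real \<Rightarrow> real^'d \<Rightarrow> complex) \<Rightarrow> bool" where
  "schroedinger_solution \<alpha> \<beta> u0 u \<longleftrightarrow>
     (\<exists>ut D1 D2.
        L1loc_H2 u D1 D2 \<and> W11loc_L2 u ut \<and>
        (AE (t, x) in lebesgue. 0 < t \<longrightarrow>
           (\<exists>y. has_caputo_derivative \<alpha> (\<lambda>s. ut s x) t y \<and>
                \<i> powr of_real \<beta> * y = - (\<Sum>b\<in>Basis. D2 b b t x)))) \<and>
     ((\<lambda>t. L2_norm (\<lambda>x. u t x - u0 x)) \<longlongrightarrow> 0) (at_right 0)"

definition mittag_leffler :: "real \<Rightarrow> real \<Rightarrow> complex \<Rightarrow> complex" where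
  "mittag_leffler \<alpha> \<gamma> z = (\<Sum>n. z ^ n / of_real (Gamma (\<alpha> * real n + \<gamma>)))"

text \<open>\<open>w\<close> is the Fourier transform, in the space variable, of the solution at a fixed time.\<close>

definition mean_square_displacement :: "(real^'d \<Rightarrow> complex) \<Rightarrow> real" where
  "mean_square_displacement w = (L2_norm (gradient w))\<^sup>2"

end

theory Submission
  imports Defs "HOL-Complex_Analysis.Residue_Theorem" "HOL-Real_Asymp.Real_Asymp"
begin

text \<open>
  Write \<open>v\<close> for the transform of the initial value, \<open>w\<close> for that of the solution,
  \<open>E\<close> for \<open>E\<^sub>\<alpha>\<^sub>,\<^sub>1\<close>, \<open>\<zeta> = (-\<i>)\<^sup>\<beta>\<close> and \<open>c = cos (\<pi>\<beta>/(2\<alpha>))\<close>. The argument of \<open>E\<close> in the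
  solution is \<open>\<zeta>r\<close> with \<open>r = |\<xi>|\<^sup>2 t\<^sup>\<alpha>\<close>, and \<open>|arg \<zeta>| = \<pi>\<beta>/2 < \<pi>\<alpha>/2\<close> because \<open>\<beta> < \<alpha>\<close>. In that
  sector \<open>E(z)\<close> behaves like \<open>exp(z\<^sup>1\<^sup>/\<^sup>\<alpha>)/\<alpha>\<close>, and \<open>|exp((\<zeta>r)\<^sup>1\<^sup>/\<^sup>\<alpha>)| = exp(c|\<xi>|\<^sup>2\<^sup>/\<^sup>\<alpha>t)\<close> with \<open>c > 0\<close>. So
  the frequency \<open>\<xi>\<close> grows at the rate \<open>c|\<xi>|\<^sup>2\<^sup>/\<^sup>\<alpha>\<close>, and the displacement is an integral over
  frequencies with \<open>\<Lambda>\<^sub>- \<le> |\<xi>| \<le> \<Lambda>\<^sub>+\<close>.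

  The asymptotics of \<open>E\<close> come from the representation of \<open>E(z) - 1\<close> as an integral of
  \<open>e\<^sup>s z/(s(s\<^sup>\<alpha> - z))\<close> over a vertical line far to the right (\<open>mittag_leffler_line_integral\<close>); it
  is the geometric series in \<open>z/s\<^sup>\<alpha>\<close>, integrated term by term with the Bromwich integral of
  \<open>1/\<Gamma>\<close> (\<open>rGamma_line_integral\<close>). Moving the line back to \<open>Re s = 1\<close> crosses a single pole, at
  \<open>s = z\<^sup>1\<^sup>/\<^sup>\<alpha>\<close>, whose residue is \<open>exp(z\<^sup>1\<^sup>/\<^sup>\<alpha>)/\<alpha>\<close>; what remains is \<open>O(|z|)\<close>
  (\<open>mittag_leffler_sector_asymptotics\<close>). Since the remainder is holomorphic in the sector, Cauchy's
  inequality on discs of radius proportional to \<open>|z|\<close> bounds its derivative by a constant. Hence both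
  \<open>E\<close> and \<open>E'\<close> are controlled on the ray (\<open>mittag_leffler_ray_bounds\<close>), which gives
  \<open>|\<nabla>\<^sub>\<xi> w| \<le> C exp(c|\<xi>|\<^sup>2\<^sup>/\<^sup>\<alpha>t) (t |v| + 1)\<close> on the support.

  The upper bound holds because a continuously differentiable \<open>v\<close> supported in \<open>|\<xi>| \<le> \<Lambda>\<^sub>+\<close> vanishes
  at the sphere \<open>|\<xi>| = \<Lambda>\<^sub>+\<close> at least linearly in \<open>x = \<Lambda>\<^sub>+ - |\<xi>|\<close>, while the exponential falls below its
  maximum at least by a factor \<open>e\<^sup>-\<^sup>k\<^sup>x\<^sup>t\<close>; as \<open>(tx)\<^sup>2 e\<^sup>-\<^sup>k\<^sup>x\<^sup>t\<close> is bounded, the displacement is at most a constant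
  times the exponential at \<open>\<Lambda>\<^sub>+\<close> (\<open>displacement_upper_bound\<close>), and a remainder \<open>const/t\<close> absorbs it.
  The lower bound holds because \<open>v\<close>, unless it is zero, is nonzero on a ball on which
  \<open>|\<xi>| \<ge> \<rho> > \<Lambda>\<^sub>-\<close>; there the squared gradient is at least \<open>exp(2c\<rho>\<^sup>2\<^sup>/\<^sup>\<alpha>t)\<close>
  (\<open>displacement_lower_bound\<close>), which beats \<open>t exp(2c\<Lambda>\<^sub>-\<^sup>2\<^sup>/\<^sup>\<alpha>t)\<close>. So the remainder on the left can be
  taken to be zero.
\<close>

section \<open>Integrals along vertical lines\<close>

lemma integrable_powr_decay:
  fixes g :: "real \<Rightarrow> complex"
  assumes cont: "continuous_on UNIV g" and p: "p > 1" and T: "T > 0"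
    and decay: "\<And>y. \<bar>y\<bar> \<ge> T \<Longrightarrow> norm (g y) \<le> K * \<bar>y\<bar> powr (- p)"
  shows "integrable lborel g"
proof -
  have "((\<lambda>y. y powr (-p)) has_integral -(T powr (-p+1)) / (-p+1)) {T..}"
    using p T by (intro has_integral_powr_to_inf) auto
  then have "(\<lambda>y. y powr (-p)) absolutely_integrable_on {T..}"
    using nonnegative_absolutely_integrable_1 by (metis has_integral_integrable powr_ge_zero)
  then have tail: "integrable lborel (\<lambda>y. indicator {T..} y *\<^sub>R y powr (-p))"
    unfolding set_integrable_def by (subst (asm) integrable_completion) auto
  have tail': "integrable lborel (\<lambda>y. indicator {T..} (-y) *\<^sub>R (-y) powr (-p))"
    using lborel_integrable_real_affine[OF tail, of "-1" 0] by simp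
  obtain M where M: "\<And>y. y \<in> {-T..T} \<Longrightarrow> norm (g y) \<le> M"
    using compact_imp_bounded[OF compact_continuous_image[OF continuous_on_subset[OF cont] compact_Icc]]
    unfolding bounded_iff by (metis UNIV_I image_eqI subsetI)
  have "M \<ge> 0" using order_trans[OF norm_ge_zero M[of 0]] T by simp
  define h where "h = (\<lambda>y. M * indicator {-T..T} y + \<bar>K\<bar> * (indicator {T..} y *\<^sub>R y powr (-p))
     + \<bar>K\<bar> * (indicator {T..} (-y) *\<^sub>R (-y) powr (-p)))"
  show ?thesis
  proof (rule Bochner_Integration.integrable_bound)
    show "integrable lborel h"
      unfolding h_def by (intro Bochner_Integration.integrable_add integrable_mult_right tail tail'
          integrable_real_indicator) (auto simp: emeasure_lborel_Icc_eq)
    show "g \<in> borel_measurable lborel"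
      using borel_measurable_continuous_onI[OF cont] by simp
    have "norm (g y) \<le> h y" for y
    proof (cases "\<bar>y\<bar> \<le> T")
      case True
      then show ?thesis
        using M[of y] \<open>M \<ge> 0\<close> by (auto simp: h_def abs_le_iff intro!: add_increasing2 mult_nonneg_nonneg)
    next
      case False
      have "norm (g y) \<le> \<bar>K\<bar> * \<bar>y\<bar> powr (-p)"
        using decay[of y] False by (smt (verit) mult_right_mono powr_ge_zero)
      then show ?thesis using False \<open>M \<ge> 0\<close> T
        by (cases "y > 0") (auto simp: h_def indicator_def)
    qed
    then show "AE y in lborel. norm (g y) \<le> norm (h y)"
      by (smt (verit) AE_I2 real_norm_def)
  qed
qed

text \<open>The difference of the two line integrals is the limit of the contour integral over the
  rectangle with vertical sides on the two lines and horizontal sides at heights \<open>\<plusminus>T\<close>; the decay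
  makes the horizontal sides disappear, and the residue theorem evaluates the rectangle.\<close>

lemma vertical_line_shift:
  fixes f :: "complex \<Rightarrow> complex"
  assumes ab: "0 < a" "a < b" and fin: "finite P"
    and P: "\<And>s. s \<in> P \<Longrightarrow> a < Re s \<and> Re s < b"
    and holo: "f holomorphic_on {s. 0 < Re s} - P"
    and p: "p > 1" and D: "D > 0"
    and decay: "\<And>s. a \<le> Re s \<Longrightarrow> Re s \<le> b \<Longrightarrow> \<bar>Im s\<bar> \<ge> D \<Longrightarrow> norm (f s) \<le> K * \<bar>Im s\<bar> powr (- p)"
  shows "(LBINT y. f (Complex b y)) - (LBINT y. f (Complex a y)) = 2 * pi * (\<Sum>s\<in>P. residue f s)"
proof -
  have contf: "continuous_on ({s. 0 < Re s} - P) f"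
    using holo holomorphic_on_imp_continuous_on by blast
  have cont: "continuous_on UNIV (\<lambda>y. f (Complex c y))" if "c = a \<or> c = b" for c
  proof -
    have "Complex c y \<in> {s. 0 < Re s} - P" for y using that ab P by force
    then show ?thesis
      by (intro continuous_on_compose2[OF contf]) (auto simp: Complex_eq intro!: continuous_intros)
  qed
  have int: "integrable lborel (\<lambda>y. f (Complex c y))" if "c = a \<or> c = b" for c
    using that ab decay[of "Complex c _"] by (intro integrable_powr_decay[OF cont p D, of c K]) auto
  define V where "V = (\<lambda>c T. integral {-T..T} (\<lambda>y. f (Complex c y)))"
  have V: "((\<lambda>T. V c T) \<longlongrightarrow> (LBINT y. f (Complex c y))) at_top" if c: "c = a \<or> c = b" for c
  proof -
    have "((\<lambda>T. \<integral>y. indicator {-T..T} y *\<^sub>R f (Complex c y) \<partial>lborel) \<longlongrightarrow> (LBINT y. f (Complex c y))) at_top"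
    proof (rule integral_dominated_convergence_at_top[where w="\<lambda>y. norm (f (Complex c y))"])
      show "AE y in lborel. ((\<lambda>T. indicator {-T..T} y *\<^sub>R f (Complex c y)) \<longlongrightarrow> f (Complex c y)) at_top"
      proof (rule AE_I2)
        fix y
        have "eventually (\<lambda>T. indicator {-T..T} y *\<^sub>R f (Complex c y) = f (Complex c y)) at_top"
          using eventually_ge_at_top[of "\<bar>y\<bar>"] by eventually_elim (auto simp: indicator_def)
        then show "((\<lambda>T. indicator {-T..T} y *\<^sub>R f (Complex c y)) \<longlongrightarrow> f (Complex c y)) at_top"
          by (rule tendsto_eventually)
      qed
    qed (use int[OF c] in \<open>auto simp: indicator_def\<close>)
    moreover have "(\<integral>y. indicator {-T..T} y *\<^sub>R f (Complex c y) \<partial>lborel) = V c T" for T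
    proof -
      have "set_integrable lborel {-T..T} (\<lambda>y. f (Complex c y))"
        unfolding set_integrable_def using int[OF c] by (intro integrable_mult_indicator) auto
      then show ?thesis unfolding V_def using set_borel_integral_eq_integral(2)
        unfolding set_lebesgue_integral_def by blast
    qed
    ultimately show ?thesis by simp
  qed
  obtain T1 where T1: "\<And>s. s \<in> P \<Longrightarrow> \<bar>Im s\<bar> < T1"
  proof -
    have "finite ((\<lambda>s. \<bar>Im s\<bar>) ` P)" using fin by simp
    then obtain M where "\<forall>x \<in> (\<lambda>s. \<bar>Im s\<bar>) ` P. x < M"
      by (meson finite_set_of_finite_funs bdd_above_finite bdd_above.unfold gt_ex order_le_less_trans)
    then show ?thesis using that by blast
  qed
  \<comment> \<open>the contribution of the two horizontal sides\<close>
  define H where "H = (\<lambda>T. contour_integral (linepath (Complex a (-T)) (Complex b (-T))) f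
                      + contour_integral (linepath (Complex b T) (Complex a T)) f)"
  have H0: "(H \<longlongrightarrow> 0) at_top"
  proof (rule Lim_null_comparison)
    have cont_h: "f contour_integrable_on linepath (Complex u T) (Complex v T)"
      if "u \<in> {a..b}" "v \<in> {a..b}" "\<bar>T\<bar> \<ge> T1" for u v T
    proof (rule contour_integrable_continuous_linepath, rule continuous_on_subset[OF contf])
      show "closed_segment (Complex u T) (Complex v T) \<subseteq> {s. 0 < Re s} - P"
      proof
        fix s assume "s \<in> closed_segment (Complex u T) (Complex v T)"
        then have "Im s = T" "Re s \<in> closed_segment u v" by (auto simp: closed_segment_same_Im)
        then have "Im s = T" "a \<le> Re s" using that(1,2) by (auto simp: closed_segment_eq_real_ivl split: if_splits)
        then show "s \<in> {s. 0 < Re s} - P" using T1[of s] that(3) ab by auto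
      qed
    qed
    have bnd: "norm (contour_integral (linepath (Complex u T) (Complex v T)) f) \<le> \<bar>K\<bar> * \<bar>T\<bar> powr (-p) * (b - a)"
      if "u \<in> {a..b}" "v \<in> {a..b}" "\<bar>T\<bar> \<ge> T1" "\<bar>T\<bar> \<ge> D" for u v T
    proof -
      have "norm (contour_integral (linepath (Complex u T) (Complex v T)) f)
          \<le> \<bar>K\<bar> * \<bar>T\<bar> powr (-p) * norm (Complex v T - Complex u T)"
      proof (rule contour_integral_bound_linepath[OF cont_h[OF that(1-3)]])
        fix s assume "s \<in> closed_segment (Complex u T) (Complex v T)"
        then have "Im s = T" "Re s \<in> closed_segment u v" by (auto simp: closed_segment_same_Im)
        then have "Im s = T" "a \<le> Re s" "Re s \<le> b" using that(1,2) by (auto simp: closed_segment_eq_real_ivl split: if_splits)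
        then have "norm (f s) \<le> K * \<bar>T\<bar> powr (-p)" using decay[of s] that(4) by auto
        also have "\<dots> \<le> \<bar>K\<bar> * \<bar>T\<bar> powr (-p)" by (intro mult_right_mono) auto
        finally show "norm (f s) \<le> \<bar>K\<bar> * \<bar>T\<bar> powr (-p)" .
      qed auto
      also have "norm (Complex v T - Complex u T) \<le> b - a"
        using that(1,2) by (simp add: complex_diff cmod_def abs_le_iff)
      finally show ?thesis by (simp add: mult_left_mono)
    qed
    show "\<forall>\<^sub>F T in at_top. norm (H T) \<le> 2 * \<bar>K\<bar> * (b - a) * T powr (-p)"
      using eventually_ge_at_top[of D] eventually_ge_at_top[of T1]
    proof eventually_elim
      case (elim T)
      then show ?case
        using bnd[of a b "-T"] bnd[of b a T] ab D unfolding H_def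
        by (intro order_trans[OF norm_triangle_ineq]) (auto simp: algebra_simps)
    qed
    have "((\<lambda>T. T powr (-p)) \<longlongrightarrow> 0) at_top"
      using p by (intro tendsto_neg_powr filterlim_ident) auto
    from tendsto_mult_left[OF this, of "2 * \<bar>K\<bar> * (b - a)"]
    show "((\<lambda>T. 2 * \<bar>K\<bar> * (b - a) * T powr (-p)) \<longlongrightarrow> 0) at_top" by simp
  qed
  have rect: "\<i> * V b T - \<i> * V a T + H T = 2 * pi * \<i> * (\<Sum>s\<in>P. residue f s)"
    if T: "T \<ge> T1" "T > 0" for T
  proof -
    let ?p = "Complex a (-T)" and ?q = "Complex b (-T)" and ?r = "Complex b T" and ?t = "Complex a T"
    have img: "path_image (rectpath ?p ?r) \<subseteq> {s. 0 < Re s} - P"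
      using ab P T T1 by (subst path_image_rectpath) (force simp: abs_less_iff)+
    have sub: "closed_segment ?p ?q \<subseteq> path_image (rectpath ?p ?r)"
      "closed_segment ?q ?r \<subseteq> path_image (rectpath ?p ?r)"
      "closed_segment ?r ?t \<subseteq> path_image (rectpath ?p ?r)"
      "closed_segment ?t ?p \<subseteq> path_image (rectpath ?p ?r)"
      unfolding rectpath_def Let_def by (auto simp: path_image_join)
    have ci: "f contour_integrable_on linepath ?p ?q" "f contour_integrable_on linepath ?q ?r"
       "f contour_integrable_on linepath ?r ?t" "f contour_integrable_on linepath ?t ?p"
      using sub img by (auto intro!: contour_integrable_continuous_linepath continuous_on_subset[OF contf])
    have "contour_integral (rectpath ?p ?r) f = contour_integral (linepath ?p ?q) f
       + (contour_integral (linepath ?q ?r) f + (contour_integral (linepath ?r ?t) f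
          + contour_integral (linepath ?t ?p) f))"
      unfolding rectpath_def Let_def using ci by (simp add: contour_integrable_joinI valid_path_join)
    moreover have "contour_integral (linepath ?q ?r) f = \<i> * V b T"
      unfolding V_def using T by (intro contour_integral_linepath_same_Re) auto
    moreover have "contour_integral (linepath ?t ?p) f = - (\<i> * V a T)"
    proof -
      have "contour_integral (linepath ?p ?t) f = \<i> * V a T"
        unfolding V_def using T by (intro contour_integral_linepath_same_Re) auto
      then show ?thesis by (metis contour_integral_reverse_linepath ci(4) contour_integrable_reversepath_eq
            reversepath_linepath valid_path_linepath contour_integral_reversepath)
    qed
    moreover have "contour_integral (rectpath ?p ?r) f
        = 2 * pi * \<i> * (\<Sum>s\<in>P. winding_number (rectpath ?p ?r) s * residue f s)"
    proof (rule Residue_theorem[OF _ _ fin holo _ _ img])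
      show "open {s. 0 < Re s}" by (simp add: open_halfspace_Re_gt)
      show "connected {s. 0 < Re s}" by (simp add: convex_connected convex_halfspace_Re_gt)
      show "\<forall>z. z \<notin> {s. 0 < Re s} \<longrightarrow> winding_number (rectpath ?p ?r) z = 0"
        using ab T by (auto intro!: winding_number_rectpath_outside simp: in_cbox_complex_iff)
    qed auto
    moreover have "(\<Sum>s\<in>P. winding_number (rectpath ?p ?r) s * residue f s) = (\<Sum>s\<in>P. residue f s)"
    proof (rule sum.cong)
      fix s assume "s \<in> P"
      then have "s \<in> box ?p ?r" using P T1[of s] T by (auto simp: in_box_complex_iff)
      then show "winding_number (rectpath ?p ?r) s * residue f s = residue f s"
        by (simp add: winding_number_rectpath)
    qed auto
    ultimately show ?thesis by (simp add: H_def algebra_simps)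
  qed
  have "((\<lambda>T. \<i> * V b T - \<i> * V a T + H T) \<longlongrightarrow>
     \<i> * (LBINT y. f (Complex b y)) - \<i> * (LBINT y. f (Complex a y)) + 0) at_top"
    by (intro tendsto_intros V H0) auto
  moreover have "((\<lambda>T. \<i> * V b T - \<i> * V a T + H T) \<longlongrightarrow> 2 * pi * \<i> * (\<Sum>s\<in>P. residue f s)) at_top"
    by (rule tendsto_eventually)
       (use eventually_ge_at_top[of T1] eventually_gt_at_top[of 0] in eventually_elim, use rect in blast)
  ultimately have "\<i> * ((LBINT y. f (Complex b y)) - (LBINT y. f (Complex a y)))
      = \<i> * (2 * pi * (\<Sum>s\<in>P. residue f s))"
    using tendsto_unique[OF trivial_limit_at_top_linorder] by (fastforce simp: algebra_simps)
  then show ?thesis by simp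
qed

section \<open>The reciprocal Gamma function as an inverse Laplace integral\<close>

text \<open>A non-integrable \<open>f\<close> has integral \<open>0\<close>, so only the majorant has to be integrable.\<close>

lemma norm_integral_le:
  fixes f :: "_ \<Rightarrow> 'a :: {banach, second_countable_topology}"
  assumes "integrable M g" "\<And>x. norm (f x) \<le> g x"
  shows "norm (integral\<^sup>L M f) \<le> integral\<^sup>L M g"
  using assms order_trans[OF norm_ge_zero assms(2)]
  by (intro order_trans[OF integral_norm_bound integral_mono']) auto

lemma norm_Complex_ge: "a \<ge> 0 \<Longrightarrow> a \<le> norm (Complex a y)" "\<bar>y\<bar> \<le> norm (Complex a y)"
  using complex_Re_le_cmod[of "Complex a y"] abs_Im_le_cmod[of "Complex a y"] by auto

lemma continuous_on_Complex_line: "continuous_on UNIV (\<lambda>y. Complex a y)"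
  by (auto simp: Complex_eq intro!: continuous_intros)

lemma continuous_on_line_powr:
  "a > 0 \<Longrightarrow> continuous_on UNIV (\<lambda>y. Complex a y powr w)"
  by (intro continuous_on_powr_complex continuous_on_Complex_line continuous_on_const)
     (auto simp: complex_nonpos_Reals_iff complex_eq_iff)

lemma holomorphic_on_right_powr: "(\<lambda>s. s powr w) holomorphic_on {s. 0 < Re s}"
  by (intro holomorphic_intros) (auto simp: complex_nonpos_Reals_iff)

lemma integrable_line_powr:
  assumes "a > 0" "q > 1"
  shows "integrable lborel (\<lambda>y. norm (Complex a y) powr (- q))"
proof -
  have "integrable lborel (\<lambda>y. Complex a y powr (of_real (-q)))"
  proof (rule integrable_powr_decay[where p=q and T=1 and K=1])
    show "continuous_on UNIV (\<lambda>y. Complex a y powr complex_of_real (- q))"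
      using assms by (intro continuous_on_line_powr)
    show "cmod (Complex a y powr complex_of_real (- q)) \<le> 1 * \<bar>y\<bar> powr - q" if "1 \<le> \<bar>y\<bar>" for y
      using that assms powr_mono2'[OF _ _ norm_Complex_ge(2), of "-q" y a]
      by (subst norm_powr_real_powr') auto
  qed (use assms in auto)
  then have "integrable lborel (\<lambda>y. norm (Complex a y powr (of_real (-q))))" by simp
  then show ?thesis by (subst (asm) norm_powr_real_powr') auto
qed

lemma bromwich_line_independent:
  assumes x: "x > 1" and "a > 0" "b > 0"
  shows "(LBINT y. exp (Complex a y) * Complex a y powr (- of_real x))
       = (LBINT y. exp (Complex b y) * Complex b y powr (- of_real x))"
proof -
  have *: "(LBINT y. exp (Complex a y) * Complex a y powr (- of_real x))
       = (LBINT y. exp (Complex b y) * Complex b y powr (- of_real x))"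
    if "0 < a" "a < b" for a b
  proof -
    have "(LBINT y. exp (Complex b y) * Complex b y powr (- of_real x))
       - (LBINT y. exp (Complex a y) * Complex a y powr (- of_real x)) = 2 * pi * (\<Sum>s\<in>{}. residue
        (\<lambda>s. exp s * s powr (- of_real x)) s)"
    proof (rule vertical_line_shift[OF that, where p=x and D=1 and K="exp b"])
      show "(\<lambda>s. exp s * s powr - complex_of_real x) holomorphic_on {s. 0 < Re s} - {}"
        unfolding Diff_empty by (intro holomorphic_on_mult holomorphic_on_right_powr holomorphic_on_exp)
      fix s assume s: "a \<le> Re s" "Re s \<le> b" "1 \<le> \<bar>Im s\<bar>"
      have "norm s powr (-x) \<le> \<bar>Im s\<bar> powr (-x)"
        using s x by (intro powr_mono2' abs_Im_le_cmod) auto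
      then show "cmod (exp s * s powr - complex_of_real x) \<le> exp b * \<bar>Im s\<bar> powr - x"
        using s by (auto simp: norm_mult norm_powr_real_powr' intro!: mult_mono)
    qed (use x in auto)
    then show ?thesis by simp
  qed
  show ?thesis
  proof (cases a b rule: linorder_cases)
    case less
    then show ?thesis by (rule *[OF assms(2)])
  next
    case greater
    then show ?thesis by (rule *[OF assms(3), symmetric])
  qed simp
qed

lemma integrable_exp_decay:
  fixes c :: real
  assumes "c > 0"
  shows "integrable lborel (\<lambda>t. indicator {0<..} t *\<^sub>R exp (- (c * t)))"
proof -
  have "(\<lambda>t. complex_of_real t powr (1 - 1) / of_real (exp (c * t))) absolutely_integrable_on {0<..}"
    using assms by (intro absolutely_integrable_Gamma_integral) auto
  then have "integrable lebesgue (\<lambda>t. norm (indicator {0<..} t *\<^sub>R (complex_of_real t powr (1 - 1) / of_real (exp (c * t)))))"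
    unfolding set_integrable_def by (rule integrable_norm)
  moreover have eq: "norm (indicator {0<..} t *\<^sub>R (complex_of_real t powr (1 - 1) / of_real (exp (c * t))))
      = indicator {0<..} t *\<^sub>R exp (- (c * t))" for t :: real
    by (cases "t > 0") (simp_all add: norm_divide exp_minus inverse_eq_divide)
  ultimately have "integrable lebesgue (\<lambda>t. indicator {0<..} t *\<^sub>R exp (- (c * t)))"
    by (simp only: eq)
  then show ?thesis by (subst (asm) integrable_completion) auto
qed

lemma integral_exp_decay_complex:
  assumes "Re w > 0"
  shows "(LBINT t. indicator {0<..} t *\<^sub>R exp (- (of_real t * w))) = 1 / w"
proof -
  have w: "w \<noteq> 0" using assms by auto
  have int: "set_integrable lborel {0<..} (\<lambda>t. exp (- (of_real t * w)))"
    unfolding set_integrable_def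
    by (rule Bochner_Integration.integrable_bound[OF integrable_exp_decay[OF assms]])
       (auto simp: mult.commute)
  have "(LBINT t=0..\<infinity>. exp (- (of_real t * w))) = 0 - (- 1 / w)"
  proof (rule interval_integral_FTC_integrable[where F="\<lambda>t. - exp (- (of_real t * w)) / w"])
    show "((\<lambda>t. - exp (- (complex_of_real t * w)) / w) has_vector_derivative exp (- (complex_of_real t * w))) (at t)"
      if "0 < ereal t" "ereal t < \<infinity>" for t
    proof -
      have "((\<lambda>t. - exp (- (t * w)) / w) has_field_derivative exp (- (of_real t * w))) (at (complex_of_real t))"
        using w by (auto intro!: derivative_eq_intros)
      then show ?thesis using has_vector_derivative_real_field by fastforce
    qed
    show "(((\<lambda>t. - exp (- (complex_of_real t * w)) / w) \<circ> real_of_ereal) \<longlongrightarrow> - 1 / w) (at_right 0)"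
      unfolding zero_ereal_def ereal_tendsto_simps
      using w by (auto intro!: tendsto_eq_intros)
    show "(((\<lambda>t. - exp (- (complex_of_real t * w)) / w) \<circ> real_of_ereal) \<longlongrightarrow> 0) (at_left \<infinity>)"
      unfolding ereal_tendsto_simps
    proof (rule tendsto_norm_zero_cancel)
      have "((\<lambda>t. exp (- (t * Re w)) / norm w) \<longlongrightarrow> 0) at_top"
        using assms w by real_asymp
      then show "((\<lambda>t. cmod (- exp (- (complex_of_real t * w)) / w)) \<longlongrightarrow> 0) at_top"
        by (simp add: norm_divide)
    qed
  qed (use int in \<open>auto simp: zero_ereal_def intro!: continuous_intros\<close>)
  then show ?thesis
    by (simp add: interval_lebesgue_integral_def set_lebesgue_integral_def zero_ereal_def)
qed

text \<open>Cauchy's formula in the half plane \<open>Re s > 1/2\<close> for \<open>s\<^sup>-\<^sup>x\<close> at \<open>s = 1\<close>: moving the line to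
  \<open>Re s = A\<close> crosses the pole \<open>s = 1\<close>, and the integral over the far line tends to \<open>0\<close> as
  \<open>A\<close> grows.\<close>

lemma cauchy_right_half_plane_at_1:
  assumes x: "x > 1"
  shows "(LBINT y. Complex (1/2) y powr (- of_real x) / (1 - Complex (1/2) y)) = 2 * pi"
proof -
  define f where "f = (\<lambda>s::complex. s powr (- of_real x) / (1 - s))"
  \<comment> \<open>of the decay exponent \<open>x\<close>, the part \<open>q > 1\<close> pays for integrability and \<open>x - q > 0\<close> for the limit in \<open>A\<close>\<close>
  define q where "q = (x + 1) / 2"
  define W where "W = (LBINT y. norm (Complex 1 y) powr (-q))"
  have q: "q > 1" "x - q > 0" using x by (auto simp: q_def field_simps)
  have shift: "(LBINT y. f (Complex A y)) - (LBINT y. f (Complex (1/2) y)) = - 2 * pi" if A: "A \<ge> 2" for A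
  proof -
    have "(LBINT y. f (Complex A y)) - (LBINT y. f (Complex (1/2) y)) = 2 * pi * (\<Sum>s\<in>{1}. residue f s)"
    proof (rule vertical_line_shift[where p=x and D=1 and K=1])
      show "f holomorphic_on {s. 0 < Re s} - {1}" unfolding f_def
        by (auto intro!: holomorphic_intros simp: complex_nonpos_Reals_iff)
      fix s assume s: "1 \<le> \<bar>Im s\<bar>"
      have "norm s powr (-x) \<le> \<bar>Im s\<bar> powr (-x)"
        using s x by (intro powr_mono2' abs_Im_le_cmod) auto
      moreover have "norm (1 - s) \<ge> 1" using s abs_Im_le_cmod[of "1 - s"] by simp
      then have "norm s powr (-x) / norm (1 - s) \<le> norm s powr (-x)"
        by (intro divide_left_mono[of 1 _ _, simplified]) auto
      ultimately show "cmod (f s) \<le> 1 * \<bar>Im s\<bar> powr - x"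
        by (simp add: f_def norm_divide norm_powr_real_powr')
    qed (use A x in auto)
    moreover have "residue f 1 = -1"
    proof -
      have "residue (\<lambda>s. - (s powr (- of_real x)) / (s - 1)) 1 = - (1 powr (- complex_of_real x))"
        by (intro residue_simple[of "{s. 0 < Re s}"])
           (auto simp: open_halfspace_Re_gt complex_nonpos_Reals_iff intro!: holomorphic_intros)
      moreover have "f = (\<lambda>s. - (s powr (- of_real x)) / (s - 1))"
        using minus_divide_divide[of _ "1 - s" for s :: complex] by (simp add: f_def fun_eq_iff)
      ultimately show ?thesis by simp
    qed
    ultimately show ?thesis by simp
  qed
  have small: "norm (LBINT y. f (Complex A y)) \<le> A powr (-(x - q)) * W" if A: "A \<ge> 2" for A
  proof -
    have "norm (LBINT y. f (Complex A y)) \<le> (LBINT y. A powr (-(x - q)) * norm (Complex 1 y) powr (-q))"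
    proof (rule norm_integral_le)
      show "integrable lborel (\<lambda>y. A powr (-(x - q)) * norm (Complex 1 y) powr (-q))"
        using integrable_line_powr[of 1 q] q by simp
      fix y
      let ?s = "Complex A y"
      have "norm (1 - ?s) \<ge> 1" using A abs_Re_le_cmod[of "1 - ?s"] by simp
      then have "norm (f ?s) \<le> norm ?s powr (-x)"
        unfolding f_def by (simp add: norm_divide norm_powr_real_powr') (intro divide_left_mono[of 1 _ _, simplified], auto)
      also have "\<dots> = norm ?s powr (-(x-q)) * norm ?s powr (-q)"
        by (simp add: powr_add[symmetric])
      also have "\<dots> \<le> A powr (-(x - q)) * norm (Complex 1 y) powr (-q)"
      proof (intro mult_mono powr_mono2')
        show "norm (Complex 1 y) \<le> norm ?s" using A by (simp add: cmod_def)
        show "A \<le> norm ?s" using A norm_Complex_ge(1)[of A y] by simp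
      qed (use A q norm_Complex_ge(1)[of 1 y] in \<open>auto simp: cmod_def add_pos_nonneg\<close>)
      finally show "norm (f ?s) \<le> A powr (-(x - q)) * norm (Complex 1 y) powr (-q)" .
    qed
    then show ?thesis by (simp add: W_def)
  qed
  have "norm ((LBINT y. f (Complex (1/2) y)) - 2 * pi) \<le> 0"
  proof (rule tendsto_lowerbound)
    have "((\<lambda>A. A powr (-(x - q))) \<longlongrightarrow> 0) at_top"
      using q by (intro tendsto_neg_powr filterlim_ident) auto
    from tendsto_mult_right[OF this, of W]
    show "((\<lambda>A. A powr (-(x - q)) * W) \<longlongrightarrow> 0) at_top" by simp
    show "\<forall>\<^sub>F A in at_top. norm ((LBINT y. f (Complex (1/2) y)) - 2 * pi) \<le> A powr (-(x - q)) * W"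
      using eventually_ge_at_top[of 2]
    proof eventually_elim
      case (elim A)
      have "(LBINT y. f (Complex (1/2) y)) - 2 * pi = (LBINT y. f (Complex A y))"
        using shift[OF elim] by (simp add: algebra_simps)
      then show ?case using small[OF elim] by simp
    qed
  qed auto
  then show ?thesis by (simp add: f_def)
qed

text \<open>Substituting \<open>s/t\<close> for \<open>s\<close> moves the line to \<open>Re s = t/2\<close>, which does not matter by
  independence of the line: as a function of \<open>t\<close>, the inverse Laplace transform of \<open>s\<^sup>-\<^sup>x\<close> is a
  multiple of \<open>t\<^sup>x\<^sup>-\<^sup>1\<close>.\<close>

lemma bromwich_line_scale:
  assumes x: "x > 1" and t: "t > 0" 
  shows "(LBINT y. exp (of_real t * Complex (1/2) y) * Complex (1/2) y powr (- of_real x))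
     = of_real (t powr (x - 1)) * (LBINT y. exp (Complex 1 y) * Complex 1 y powr (- of_real x))"
proof -
  let ?F = "\<lambda>s. exp s * s powr (- complex_of_real x)"
  have *: "Complex (t/2) (0 + t * y) = of_real t * Complex (1/2) y" for y
    by (simp add: complex_eq_iff)
  have "(LBINT y. ?F (Complex 1 y)) = (LBINT y. ?F (Complex (t/2) y))"
    using bromwich_line_independent[OF x, of 1 "t/2"] t by simp
  also have "\<dots> = t *\<^sub>R (LBINT y. ?F (Complex (t/2) (0 + t * y)))"
    using t by (subst lborel_integral_real_affine[of t _ 0]) auto
  also have "\<dots> = t *\<^sub>R (LBINT y. of_real (t powr (-x)) * (exp (of_real t * Complex (1/2) y) * Complex (1/2) y powr (- of_real x)))"
    unfolding * using t by (subst powr_times_real_left) (auto simp: powr_Reals_eq mult_ac simp flip: of_real_minus)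
  also have "\<dots> = of_real (t * t powr (-x)) * (LBINT y. (exp (of_real t * Complex (1/2) y) * Complex (1/2) y powr (- of_real x)))"
    by (simp add: scaleR_conv_of_real)
  also have "t * t powr (-x) = t powr (1 - x)"
    using t by (simp add: powr_diff powr_minus field_simps)
  finally have "of_real (t powr (x - 1)) * (LBINT y. ?F (Complex 1 y)) = of_real (t powr (x - 1) * t powr (1 - x)) * (LBINT y. (exp (of_real t * Complex (1/2) y) * Complex (1/2) y powr (- of_real x)))"
    by simp
  also have "t powr (x - 1) * t powr (1 - x) = 1" using t by (simp flip: powr_add)
  finally show ?thesis by simp
qed

lemma lborel_integral_Gamma:
  assumes x: "x > (0::real)"
  shows "(LBINT t. indicator {0<..} t *\<^sub>R (t powr (x - 1) / exp t)) = Gamma x"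
proof -
  let ?g = "\<lambda>t. t powr (x - 1) / exp t"
  have g: "(?g has_integral Gamma x) {0..}" using x by (intro Gamma_integral_real) auto
  then have "?g absolutely_integrable_on {0..}"
    by (intro nonnegative_absolutely_integrable_1) auto
  then have "set_integrable lborel {0..} ?g"
    unfolding set_integrable_def by (subst (asm) integrable_completion) auto
  from set_borel_integral_eq_integral(2)[OF this]
  have 1: "set_lebesgue_integral lborel {0..} ?g = Gamma x"
    using integral_unique[OF g] by simp
  have 2: "(\<lambda>t. indicator {0..} t *\<^sub>R ?g t) = (\<lambda>t. indicator {0<..} t *\<^sub>R ?g t)"
    by (rule ext) (auto simp: indicator_def)
  show ?thesis using 1 unfolding set_lebesgue_integral_def 2 .
qed

text \<open>The constant in the previous lemma is found by applying the Laplace transform at \<open>1\<close>. On the one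
  hand it turns \<open>t\<^sup>x\<^sup>-\<^sup>1\<close> into \<open>\<Gamma>(x)\<close>. On the other hand, by Fubini, it acts under the line integral and
  turns \<open>e\<^sup>s\<^sup>t\<close> into \<open>1/(1 - s)\<close>, which leaves Cauchy's formula for \<open>s\<^sup>-\<^sup>x\<close> at \<open>1\<close>.\<close>

lemma rGamma_line_integral:
  assumes x: "x > 1" and a: "a > 0"
  shows "(LBINT y. exp (Complex a y) * Complex a y powr (- of_real x)) = of_real (2 * pi / Gamma x)"
proof -
  define I where "I = (LBINT y. exp (Complex 1 y) * Complex 1 y powr (- of_real x))"
  define S where "S = (\<lambda>y. Complex (1/2) y)"
  define F where "F = (\<lambda>t y. indicator {0<..} t *\<^sub>R (exp (- (of_real t * (1 - S y))) * S y powr (- of_real x)))"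
  have S_meas: "S \<in> borel_measurable borel" "(\<lambda>y. S y powr (- of_real x)) \<in> borel_measurable borel"
    unfolding S_def by (intro borel_measurable_continuous_onI continuous_on_Complex_line continuous_on_line_powr; simp)+
  note [measurable] = S_meas
  have normF: "norm (F t y) = (indicator {0<..} t *\<^sub>R exp (- t / 2)) * norm (S y) powr (-x)" for t y
    by (simp add: F_def S_def norm_mult norm_powr_real_powr' indicator_def)
  have powr_int: "integrable lborel (\<lambda>y. norm (S y) powr (-x))"
    unfolding S_def using x by (intro integrable_line_powr) auto
  have exp_int: "integrable lborel (\<lambda>t::real. indicator {0<..} t *\<^sub>R exp (- t / 2))"
    using integrable_exp_decay[of "1/2"] by simp
  have FM: "(\<lambda>(t, y). F t y) \<in> borel_measurable (lborel \<Otimes>\<^sub>M lborel)"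
    unfolding F_def by measurable
  have Fint: "integrable (lborel \<Otimes>\<^sub>M lborel) (\<lambda>(t, y). F t y)"
  proof (rule lborel_pair.Fubini_integrable[OF FM])
    show "integrable lborel (\<lambda>t. LBINT y. norm (case (t, y) of (t, y) \<Rightarrow> F t y))"
      using exp_int by (simp add: normF)
    show "AE t in lborel. integrable lborel (\<lambda>y. case (t, y) of (t, y) \<Rightarrow> F t y)"
    proof (rule AE_I2)
      fix t
      show "integrable lborel (\<lambda>y. case (t, y) of (t, y) \<Rightarrow> F t y)"
      proof (rule integrable_norm_cancel)
        show "integrable lborel (\<lambda>y. norm (case (t, y) of (t, y) \<Rightarrow> F t y))"
          using powr_int by (simp add: normF)
        show "(\<lambda>y. case (t, y) of (t, y) \<Rightarrow> F t y) \<in> borel_measurable lborel"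
          unfolding F_def by simp
      qed
    qed
  qed
  have "(LBINT t. LBINT y. F t y) = (LBINT t. of_real (indicator {0<..} t *\<^sub>R (t powr (x - 1) / exp t)) * I)"
  proof (rule Bochner_Integration.integral_cong[OF refl])
    fix t :: real
    show "(LBINT y. F t y) = of_real (indicator {0<..} t *\<^sub>R (t powr (x - 1) / exp t)) * I"
    proof (cases "t > 0")
      case True
      have "F t y = of_real (exp (-t)) * (exp (of_real t * Complex (1/2) y) * Complex (1/2) y powr (- of_real x))" for y
      proof -
        have "exp (- (of_real t * (1 - S y))) = exp (of_real (-t)) * exp (of_real t * S y)"
          by (simp add: algebra_simps flip: exp_add)
        also have "exp (complex_of_real (-t)) = of_real (exp (-t))" by (simp only: exp_of_real)
        finally have e: "exp (- (of_real t * (1 - S y))) = of_real (exp (-t)) * exp (of_real t * S y)" .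
        have "F t y = exp (- (of_real t * (1 - S y))) * S y powr (- of_real x)" using True by (simp add: F_def)
        then show ?thesis unfolding e by (simp only: mult.assoc S_def)
      qed
      then have "(LBINT y. F t y) = of_real (exp (-t)) * (of_real (t powr (x - 1)) * I)"
        using bromwich_line_scale[OF x True] by (simp only: I_def integral_mult_right_zero)
      moreover have "t powr (x - 1) / exp t = exp (-t) * t powr (x - 1)"
        by (simp add: exp_minus field_simps)
      moreover have "indicator {0<..} t *\<^sub>R (t powr (x - 1) / exp t) = t powr (x - 1) / exp t" using True by simp
      ultimately show ?thesis by (simp only: mult.assoc of_real_mult)
    qed (simp add: F_def)
  qed
  also have "\<dots> = of_real (Gamma x) * I"
  proof -
    have "(LBINT t. complex_of_real (indicator {0<..} t *\<^sub>R (t powr (x - 1) / exp t)) * I)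
        = complex_of_real (LBINT t. indicator {0<..} t *\<^sub>R (t powr (x - 1) / exp t)) * I"
      by (subst integral_mult_left_zero) (simp only: integral_complex_of_real)
    then show ?thesis using lborel_integral_Gamma[of x] x by simp
  qed
  finally have 1: "(LBINT t. LBINT y. F t y) = of_real (Gamma x) * I" .
  have "(LBINT y. LBINT t. F t y) = (LBINT y. S y powr (- of_real x) / (1 - S y))"
  proof (rule Bochner_Integration.integral_cong[OF refl])
    fix y
    have "(LBINT t. F t y) = (LBINT t. (indicator {0<..} t *\<^sub>R exp (- (of_real t * (1 - S y)))) * S y powr (- of_real x))"
      by (simp add: F_def)
    also have "\<dots> = (LBINT t. indicator {0<..} t *\<^sub>R exp (- (of_real t * (1 - S y)))) * S y powr (- of_real x)"
      by (rule integral_mult_left_zero)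
    also have "\<dots> = S y powr (- of_real x) / (1 - S y)"
      by (subst integral_exp_decay_complex) (auto simp: S_def)
    finally show "(LBINT t. F t y) = S y powr (- of_real x) / (1 - S y)" .
  qed
  also have "\<dots> = 2 * pi" using cauchy_right_half_plane_at_1[OF x] by (simp add: S_def)
  finally have G: "of_real (Gamma x) * I = 2 * pi"
    using 1 lborel_pair.Fubini_integral[OF Fint] by simp
  have "Gamma x \<noteq> 0" using x Gamma_real_pos[of x] by linarith
  then have "I = of_real (Gamma x) * I / of_real (Gamma x)" by simp
  also have "\<dots> = of_real (2 * pi / Gamma x)" unfolding G by simp
  finally have "I = of_real (2 * pi / Gamma x)" .
  then show ?thesis using bromwich_line_independent[OF x a, of 1] by (simp add: I_def)
qed

section \<open>The Mittag-Leffler function as an inverse Laplace integral\<close>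

lemma powr_minus_Suc_eq: "r powr (- (e + 1)) = 1 / (r * r powr e)" if "r > 0" for r e :: real
  unfolding powr_minus powr_add using that by (simp add: field_simps)

text \<open>The integrand is the sum over \<open>n\<close> of \<open>e\<^sup>s z\<^sup>n\<^sup>+\<^sup>1 s\<close> to the power \<open>-(\<alpha>(n+1)+1)\<close>. Splitting off the
  first term of the Mittag-Leffler series leaves exponents larger than \<open>1\<close>, so that every integral
  converges absolutely. On a line far to the right the ratio \<open>z/s\<^sup>\<alpha>\<close> is at most \<open>1/2\<close>.\<close>

lemma mittag_leffler_line_integral:
  fixes z :: complex
  assumes \<alpha>: "0 < \<alpha>" and a: "0 < a" and z: "2 * norm z \<le> a powr \<alpha>"
  shows "(\<lambda>n. z ^ n / of_real (Gamma (\<alpha> * real n + 1))) sums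
     (1 + (LBINT y. exp (Complex a y) * z / (Complex a y * (Complex a y powr of_real \<alpha> - z))) / (2 * pi))"
proof -
  define f where "f = (\<lambda>n y. z ^ Suc n * (exp (Complex a y) * Complex a y powr (- of_real (\<alpha> * real (Suc n) + 1))))"
  have nz: "Complex a y \<noteq> 0" for y using a by (simp add: complex_eq_iff)
  have split: "Complex a y powr (- of_real (\<alpha> * real (Suc n) + 1)) = 1 / (Complex a y * (Complex a y powr of_real \<alpha>) ^ Suc n)" for n y
  proof -
    let ?s = "Complex a y"
    have e: "(?s powr of_real \<alpha>) ^ Suc n = exp (of_nat (Suc n) * (of_real \<alpha> * Ln ?s))"
      using nz by (simp only: powr_def if_False exp_of_nat_mult)
    have "?s * (?s powr of_real \<alpha>) ^ Suc n = exp (Ln ?s) * exp (of_nat (Suc n) * (of_real \<alpha> * Ln ?s))"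
      unfolding e using nz by simp
    also have "\<dots> = exp (of_real (\<alpha> * real (Suc n) + 1) * Ln ?s)"
      by (simp only: exp_add[symmetric]) (simp add: algebra_simps)
    also have "\<dots> = ?s powr (of_real (\<alpha> * real (Suc n) + 1))"
      using nz by (simp only: powr_def if_False)
    finally show ?thesis by (simp only: powr_minus inverse_eq_divide)
  qed
  have low: "norm (Complex a y powr of_real \<alpha>) \<ge> a powr \<alpha>" for y
    using a \<alpha> norm_Complex_ge(1)[of a y] by (subst norm_powr_real_powr') (auto intro!: powr_mono2)
  have nf: "norm (f n y) \<le> (1/2) ^ n * (norm z * exp a * norm (Complex a y) powr (-(\<alpha> + 1)))" for n y
  proof -
    define r where "r = norm (Complex a y)"
    have r: "r > 0" using nz by (simp add: r_def)
    have "norm z / r powr \<alpha> \<le> 1 / 2"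
      using low[of y] z r by (simp add: r_def norm_powr_real_powr' field_simps)
    then have "(norm z / r powr \<alpha>) ^ n \<le> (1 / 2) ^ n" using r by (intro power_mono) auto
    then have "(norm z / r powr \<alpha>) ^ n * (norm z * exp a * r powr (-(\<alpha> + 1))) \<le> (1/2) ^ n * (norm z * exp a * r powr (-(\<alpha> + 1)))"
      by (intro mult_right_mono) auto
    moreover have "norm (f n y) = (norm z / r powr \<alpha>) ^ n * (norm z * exp a * r powr (-(\<alpha> + 1)))"
    proof -
      have "norm (f n y) = norm z ^ Suc n * (exp a * (1 / (r * (r powr \<alpha>) ^ Suc n)))"
        unfolding f_def split by (simp only: norm_mult norm_divide norm_power norm_powr_real_powr' Reals_of_real
          Re_complex_of_real r_def norm_exp_eq_Re complex.sel norm_one)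
      then show ?thesis unfolding powr_minus_Suc_eq[OF r] using r by (simp add: power_divide field_simps)
    qed
    ultimately show ?thesis by (simp add: r_def)
  qed
  have fint: "integrable lborel (f n)" for n
  proof (rule Bochner_Integration.integrable_bound)
    show "integrable lborel (\<lambda>y. (1/2) ^ n * (norm z * exp a * norm (Complex a y) powr (-(\<alpha> + 1))))"
      using a \<alpha> by (intro integrable_mult_right integrable_line_powr) auto
    show "f n \<in> borel_measurable lborel" unfolding f_def
      using a by (simp, intro borel_measurable_continuous_onI continuous_intros continuous_on_line_powr
         continuous_on_Complex_line continuous_on_powr_complex) (auto simp: complex_nonpos_Reals_iff nz)
    show "AE y in lborel. norm (f n y) \<le> norm ((1/2) ^ n * (norm z * exp a * norm (Complex a y) powr (-(\<alpha> + 1))))"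
      using nf by (auto simp: abs_mult)
  qed
  have sums: "(\<lambda>n. f n y) sums (exp (Complex a y) * z / (Complex a y * (Complex a y powr of_real \<alpha> - z)))" for y
  proof -
    let ?w = "Complex a y powr of_real \<alpha>"
    have w: "?w \<noteq> 0" using nz by simp
    have zw: "norm (z / ?w) < 1"
    proof -
      have "norm z < norm ?w" using low[of y] z a 
        by (smt (verit) norm_ge_zero powr_gt_zero)
      then show ?thesis using w by (simp add: norm_divide)
    qed
    have neq: "?w \<noteq> z" using zw w by auto
    have "(\<lambda>n. exp (Complex a y) / Complex a y * (z / ?w) * (z / ?w) ^ n) sums
       (exp (Complex a y) / Complex a y * (z / ?w) * (1 / (1 - z / ?w)))"
      by (intro sums_mult geometric_sums zw)
    moreover have "f n y = exp (Complex a y) / Complex a y * (z / ?w) * (z / ?w) ^ n" for n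
      unfolding f_def split by (simp add: power_divide mult_ac)
    moreover have "exp (Complex a y) / Complex a y * (z / ?w) * (1 / (1 - z / ?w))
       = exp (Complex a y) * z / (Complex a y * (?w - z))"
      using w neq nz by (simp add: divide_simps)
    ultimately show ?thesis by (simp only:)
  qed
  have geo: "summable (\<lambda>n. (1/2) ^ n * C)" for C :: real
    by (intro summable_mult2 summable_geometric) simp
  have S: "(\<lambda>n. \<integral>y. f n y \<partial>lborel) sums (\<integral>y. (\<Sum>n. f n y) \<partial>lborel)"
  proof (rule sums_integral[OF fint])
    show "AE y in lborel. summable (\<lambda>n. norm (f n y))"
    proof (rule AE_I2)
      fix y
      show "summable (\<lambda>n. norm (f n y))"
        by (rule summable_comparison_test'[OF geo, of 0]) (use nf in simp)
    qed
    have "(LBINT y. norm (f n y)) \<le> (LBINT y. (1/2) ^ n * (norm z * exp a * norm (Complex a y) powr (-(\<alpha> + 1))))" for n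
      using a \<alpha> by (intro integral_mono integrable_norm fint integrable_mult_right integrable_line_powr nf) auto
    then have "norm (LBINT y. norm (f n y)) \<le> (1/2) ^ n * (LBINT y. norm z * exp a * norm (Complex a y) powr (-(\<alpha> + 1)))" for n
      by simp
    then show "summable (\<lambda>n. LBINT y. norm (f n y))"
      by (intro summable_comparison_test'[OF geo, of 0]) simp
  qed
  have I1: "(\<integral>y. f n y \<partial>lborel) = 2 * pi * (z ^ Suc n / of_real (Gamma (\<alpha> * real (Suc n) + 1)))" for n
  proof -
    have "1 < \<alpha> * real (Suc n) + 1" using \<alpha> by simp
    from rGamma_line_integral[OF this a] show ?thesis
      unfolding f_def integral_mult_right_zero by (simp only: of_real_divide) simp
  qed
  have I2: "(\<Sum>n. f n y) = exp (Complex a y) * z / (Complex a y * (Complex a y powr of_real \<alpha> - z))" for y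
    by (rule sums_unique[OF sums, symmetric])
  have "(\<lambda>n. 2 * pi * (z ^ Suc n / of_real (Gamma (\<alpha> * real (Suc n) + 1)))) sums
     (LBINT y. exp (Complex a y) * z / (Complex a y * (Complex a y powr of_real \<alpha> - z)))"
    using S unfolding I1 I2 .
  from sums_divide[OF this, of "2 * pi"]
  have "(\<lambda>n. z ^ Suc n / of_real (Gamma (\<alpha> * real (Suc n) + 1))) sums
     ((LBINT y. exp (Complex a y) * z / (Complex a y * (Complex a y powr of_real \<alpha> - z))) / (2 * pi))"
    by simp
  from sums_Suc[OF this] show ?thesis by (simp add: add.commute)
qed

text \<open>Convergence for every \<open>z\<close> is a by-product of the line integral, on a line chosen depending
  on \<open>z\<close>; no growth estimate for \<open>\<Gamma>\<close> enters.\<close>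

lemma mittag_leffler_sums:
  fixes z :: complex
  assumes \<alpha>: "0 < \<alpha>"
  shows "(\<lambda>n. z ^ n / of_real (Gamma (\<alpha> * real n + 1))) sums mittag_leffler \<alpha> 1 z"
proof -
  define a where "a = (2 * norm z + 1) powr (1 / \<alpha>)"
  have pos: "0 < 2 * norm z + 1" using norm_ge_zero[of z] by linarith
  then have "a > 0" by (simp add: a_def)
  moreover have "a powr \<alpha> = 2 * norm z + 1" unfolding a_def powr_powr using \<alpha> pos by simp
  ultimately have "a > 0" "2 * norm z \<le> a powr \<alpha>" by auto
  from sums_summable[OF mittag_leffler_line_integral[OF \<alpha> this]]
  show ?thesis unfolding mittag_leffler_def by (rule summable_sums)
qed

lemma mittag_leffler_holomorphic:
  assumes \<alpha>: "0 < \<alpha>"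
  shows "mittag_leffler \<alpha> 1 holomorphic_on A"
proof -
  have "(mittag_leffler \<alpha> 1) field_differentiable (at z)" for z
  proof -
    have "summable (\<lambda>n. (1 / of_real (Gamma (\<alpha> * real n + 1))) * z ^ n)" for z :: complex
      using sums_summable[OF mittag_leffler_sums[OF \<alpha>, of z]] by simp
    then have "((\<lambda>z. \<Sum>n. (1 / of_real (Gamma (\<alpha> * real n + 1))) * z ^ n) has_field_derivative
       (\<Sum>n. diffs (\<lambda>n. 1 / of_real (Gamma (\<alpha> * real n + 1))) n * z ^ n)) (at z)"
      by (rule termdiffs_strong_converges_everywhere)
    moreover have "(\<lambda>z. \<Sum>n. (1 / of_real (Gamma (\<alpha> * real n + 1))) * z ^ n) = mittag_leffler \<alpha> 1"
      by (simp add: mittag_leffler_def fun_eq_iff)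
    ultimately show ?thesis unfolding field_differentiable_def by auto
  qed
  then show ?thesis by (simp add: holomorphic_on_def field_differentiable_at_within)
qed

text \<open>For \<open>\<alpha> \<le> 1\<close> the power \<open>s\<^sup>\<alpha>\<close> of a point of the right half plane has argument \<open>\<alpha> arg s\<close> within
  the principal range, so the power can be undone. This makes the pole of the integrand unique.\<close>

lemma powr_eq_in_right_half_plane:
  assumes \<alpha>: "0 < \<alpha>" "\<alpha> \<le> 1" and s: "0 < Re s" and eq: "s powr of_real \<alpha> = z"
  shows "s = z powr of_real (1 / \<alpha>)"
proof -
  have s0: "s \<noteq> 0" using s by auto
  have "\<bar>Im (Ln s)\<bar> < pi / 2" using Re_Ln_pos_lt s0 s by blast
  then have "\<bar>\<alpha> * Im (Ln s)\<bar> < pi"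
    using \<alpha> mult_mono[of \<alpha> 1 "\<bar>Im (Ln s)\<bar>" "pi/2"] pi_gt_zero by (simp add: abs_mult)
  then have "Ln z = of_real \<alpha> * Ln s"
    unfolding eq[symmetric] powr_def using s0 by (simp add: Ln_exp abs_less_iff)
  moreover have "z \<noteq> 0" using eq s0 by auto
  ultimately show ?thesis using \<alpha> s0 by (simp add: powr_def)
qed

text \<open>The line integral is moved from far right to \<open>Re s = c\<close>. The only pole crossed is
  \<open>z\<^sup>1\<^sup>/\<^sup>\<alpha>\<close>, and its residue produces the exponential term.\<close>

lemma mittag_leffler_shifted_line:
  fixes z :: complex
  assumes \<alpha>: "0 < \<alpha>" "\<alpha> \<le> 1" and c: "0 < c" and z0: "z \<noteq> 0"
    and z: "c < Re (z powr of_real (1 / \<alpha>))" and arg: "\<bar>Arg z\<bar> < pi * \<alpha> / 2"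
  shows "mittag_leffler \<alpha> 1 z = 1 + exp (z powr of_real (1 / \<alpha>)) / of_real \<alpha>
     + (LBINT y. exp (Complex c y) * z / (Complex c y * (Complex c y powr of_real \<alpha> - z))) / (2 * pi)"
proof -
  define p where "p = z powr of_real (1 / \<alpha>)"
  define f where "f = (\<lambda>s. exp s * z / (s * (s powr of_real \<alpha> - z)))"
  define b where "b = max (Re p + 1) ((2 * norm z) powr (1 / \<alpha>))"
  have b: "b > Re p" "b > c" "b > 0" "2 * norm z \<le> b powr \<alpha>"
  proof -
    have "2 * norm z = ((2 * norm z) powr (1 / \<alpha>)) powr \<alpha>" using \<alpha> by (simp add: powr_powr)
    also have "\<dots> \<le> b powr \<alpha>" using \<alpha> by (intro powr_mono2) (auto simp: b_def)
    finally show "2 * norm z \<le> b powr \<alpha>" .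
  qed (use z c in \<open>auto simp: b_def p_def\<close>)
  have Lnz: "\<bar>Im (Ln z)\<bar> < pi * \<alpha> / 2" using arg z0 by (simp add: Arg_eq_Im_Ln)
  have pz: "p powr of_real \<alpha> = z"
  proof -
    have "\<bar>Im (Ln z / of_real \<alpha>)\<bar> < pi"
      using Lnz \<alpha> pi_gt_zero by (simp add: Im_divide_of_real field_simps)
    moreover have "p = exp (Ln z / of_real \<alpha>)" using z0 by (simp add: p_def powr_def)
    ultimately have "Ln p = Ln z / of_real \<alpha>" by (simp only: abs_less_iff) (rule Ln_exp, linarith+)
    moreover have "p \<noteq> 0" using z0 by (simp add: p_def)
    ultimately show ?thesis using \<alpha> z0 by (simp add: powr_def)
  qed
  have p0: "0 < Re p" "c < Re p" "p \<noteq> 0" using z c by (auto simp: p_def)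
  have zero: "s powr of_real \<alpha> = z \<longleftrightarrow> s = p" if "0 < Re s" for s
    using powr_eq_in_right_half_plane[OF \<alpha> that] pz by (auto simp: p_def)
  have "(LBINT y. f (Complex b y)) - (LBINT y. f (Complex c y)) = 2 * pi * (\<Sum>s\<in>{p}. residue f s)"
  proof (rule vertical_line_shift[where p="1 + \<alpha>" and D="(2 * norm z) powr (1 / \<alpha>)" and K="exp b * norm z * 2"])
    show "f holomorphic_on {s. 0 < Re s} - {p}"
      unfolding f_def using zero
      by (auto intro!: holomorphic_intros simp: complex_nonpos_Reals_iff)
    fix s assume s: "c \<le> Re s" "Re s \<le> b" "(2 * norm z) powr (1 / \<alpha>) \<le> \<bar>Im s\<bar>"
    have Im0: "\<bar>Im s\<bar> > 0" using s(3) z0 by (smt (verit) powr_gt_zero zero_less_norm_iff)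
    let ?w = "\<bar>Im s\<bar> powr \<alpha>"
    have "2 * norm z = ((2 * norm z) powr (1 / \<alpha>)) powr \<alpha>" using \<alpha> by (simp add: powr_powr)
    also have "\<dots> \<le> ?w" using \<alpha> s by (intro powr_mono2) auto
    finally have w: "2 * norm z \<le> ?w" .
    have "?w \<le> norm (s powr of_real \<alpha>)"
      using \<alpha> by (subst norm_powr_real_powr') (auto intro!: powr_mono2 abs_Im_le_cmod)
    then have "?w / 2 \<le> norm (s powr of_real \<alpha> - z)"
      using w norm_triangle_ineq2[of "s powr of_real \<alpha>" z] by simp
    then have "\<bar>Im s\<bar> * (?w / 2) \<le> norm s * norm (s powr of_real \<alpha> - z)"
      using abs_Im_le_cmod[of s] by (intro mult_mono) auto
    moreover have "0 < \<bar>Im s\<bar> * (?w / 2)" using Im0 by simp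
    ultimately have "exp (Re s) * norm z / (norm s * norm (s powr of_real \<alpha> - z)) \<le> exp b * norm z / (\<bar>Im s\<bar> * (?w / 2))"
      using s by (intro frac_le mult_right_mono) auto
    then have "norm (f s) \<le> exp b * norm z / (\<bar>Im s\<bar> * (?w / 2))"
      by (simp add: f_def norm_mult norm_divide)
    also have "\<dots> = exp b * norm z * 2 * \<bar>Im s\<bar> powr - (1 + \<alpha>)"
      using powr_minus_Suc_eq[OF Im0, of \<alpha>] by (simp add: add.commute)
    finally show "cmod (f s) \<le> exp b * norm z * 2 * \<bar>Im s\<bar> powr - (1 + \<alpha>)" .
  qed (use b c p0 \<alpha> z0 in auto)
  moreover have "residue f p = exp p / of_real \<alpha>"
  proof -
    have "((\<lambda>s. s powr of_real \<alpha> - z) has_field_derivative of_real \<alpha> * p powr (of_real \<alpha> - 1)) (at p)"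
      using p0 by (auto intro!: derivative_eq_intros simp: complex_nonpos_Reals_iff)
    moreover have "p powr (of_real \<alpha> - 1) = z / p" using pz p0 by (simp add: powr_diff)
    ultimately have d: "((\<lambda>s. s powr of_real \<alpha> - z) has_field_derivative of_real \<alpha> * (z / p)) (at p)" by simp
    have "residue (\<lambda>s. (exp s * z / s) / (s powr of_real \<alpha> - z)) p = (exp p * z / p) / (of_real \<alpha> * (z / p))"
    proof (rule residue_simple_pole_deriv[where s="{s. 0 < Re s}"])
      show "connected {s. 0 < Re s}" by (intro convex_connected convex_halfspace_Re_gt)
      show "(\<lambda>s. exp s * z / s) holomorphic_on {s. 0 < Re s}" by (auto intro!: holomorphic_intros)
      show "(\<lambda>s. s powr of_real \<alpha> - z) holomorphic_on {s. 0 < Re s}"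
        by (intro holomorphic_on_diff holomorphic_on_right_powr holomorphic_on_const)
    qed (use d p0 z0 \<alpha>(1) in \<open>simp_all add: open_halfspace_Re_gt pz\<close>)
    moreover have "(exp p * z / p) / (of_real \<alpha> * (z / p)) = exp p / of_real \<alpha>"
      using p0 z0 by simp
    moreover have "(\<lambda>s. (exp s * z / s) / (s powr of_real \<alpha> - z)) = f" by (simp add: f_def fun_eq_iff)
    ultimately show ?thesis by simp
  qed
  moreover have "mittag_leffler \<alpha> 1 z = 1 + (LBINT y. f (Complex b y)) / (2 * pi)"
    unfolding f_def by (rule sums_unique2[OF mittag_leffler_sums[OF \<alpha>(1)]
       mittag_leffler_line_integral[OF \<alpha>(1) b(3,4)]])
  ultimately show ?thesis
    by (simp add: f_def p_def field_simps)
qed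

section \<open>Asymptotics of the Mittag-Leffler function in a sector\<close>

lemma powr_polar:
  fixes z :: complex
  assumes "z \<noteq> 0"
  shows "z powr of_real a = of_real (norm z powr a) * cis (a * Arg z)"
proof -
  have "Ln z = of_real (ln (norm z)) + \<i> * of_real (Arg z)"
    using assms by (simp add: complex_eq_iff Arg_eq_Im_Ln)
  then have "z powr of_real a = exp (of_real (a * ln (norm z)) + \<i> * of_real (a * Arg z))"
    using assms by (simp add: powr_def algebra_simps)
  also have "\<dots> = of_real (exp (a * ln (norm z))) * cis (a * Arg z)"
    by (simp only: exp_add exp_of_real cis_conv_exp)
  finally show ?thesis using assms by (simp add: powr_def)
qed

lemma sin_lower_between:
  assumes "0 < d" "d \<le> x" "x \<le> e" "e < pi"
  shows "min (sin d) (sin e) \<le> sin x"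
proof (cases "x \<le> pi / 2")
  case True
  then have "sin d \<le> sin x" using assms by (intro sin_monotone_2pi_le) auto
  then show ?thesis by simp
next
  case False
  then have "sin (pi - e) \<le> sin (pi - x)" using assms by (intro sin_monotone_2pi_le) auto
  then show ?thesis by simp
qed

text \<open>On the line \<open>Re s = 1\<close> either \<open>|s|\<close> is bounded, and then \<open>s\<^sup>\<alpha>\<close> is small compared with a large
  \<open>z\<close>; or \<open>s\<close> is nearly vertical, and then the argument of \<open>s\<^sup>\<alpha>\<close> is close to \<open>\<plusminus>\<pi>\<alpha>/2\<close> and stays away
  from that of \<open>z\<close>, so that the distance from \<open>s\<^sup>\<alpha>\<close> to the ray through \<open>z\<close> is of the order of
  \<open>|s\<^sup>\<alpha>|\<close>.\<close>

lemma resolvent_lower_bound: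
  assumes \<alpha>: "0 < \<alpha>" "\<alpha> \<le> 1" and \<theta>: "0 \<le> \<theta>" "\<theta> < pi * \<alpha> / 2"
  obtains \<kappa> R where "\<kappa> > 0" "R > 0"
    "\<And>z y. R \<le> norm z \<Longrightarrow> \<bar>Arg z\<bar> \<le> \<theta> \<Longrightarrow>
      \<kappa> * norm (Complex 1 y) powr \<alpha> \<le> norm (Complex 1 y powr of_real \<alpha> - z)"
proof -
  define \<theta>3 where "\<theta>3 = (\<theta> / \<alpha> + pi / 2) / 2"
  have \<theta>': "\<theta> / \<alpha> < pi / 2" using \<alpha> \<theta> by (simp add: field_simps)
  have \<theta>3: "\<theta> / \<alpha> < \<theta>3" "\<theta>3 < pi / 2" "0 < \<theta>3" using \<theta>' \<theta> \<alpha> by (auto simp: \<theta>3_def add_nonneg_pos)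
  \<comment> \<open>\<open>1 = Re s = |s| cos (arg s)\<close>, so \<open>|s| > S0\<close> exactly when \<open>|arg s| > \<theta>3\<close>\<close>
  define S0 where "S0 = 1 / cos \<theta>3"
  have cos3: "cos \<theta>3 > 0" using \<theta>3 by (intro cos_gt_zero_pi) auto
  define d where "d = \<alpha> * \<theta>3 - \<theta>"
  define e where "e = pi * \<alpha> / 2 + \<theta>"
  have d: "0 < d" using \<theta>3(1) \<alpha> by (simp add: d_def field_simps)
  have "pi * \<alpha> \<le> pi" using \<alpha> by simp
  then have e: "e < pi" "0 < e"
    using \<theta> mult_pos_pos[OF pi_gt_zero \<alpha>(1)] unfolding e_def by linarith+
  define \<kappa> where "\<kappa> = min (min (sin d) (sin e)) 1"
  have "\<alpha> * \<theta>3 < \<alpha> * (pi/2)" using \<alpha> \<theta>3 by (intro mult_strict_left_mono)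
  then have dpi: "d < pi" 
    using e(1) \<theta> mult.commute[of pi \<alpha>] unfolding d_def e_def by simp
  show ?thesis
  proof
    show "\<kappa> > 0" using d dpi e by (simp add: \<kappa>_def sin_gt_zero)
    show "2 * S0 powr \<alpha> > 0" using cos3 by (simp add: S0_def)
    fix z y assume z: "2 * S0 powr \<alpha> \<le> norm z" "\<bar>Arg z\<bar> \<le> \<theta>"
    let ?s = "Complex 1 y"
    have s0: "?s \<noteq> 0" by (simp add: complex_eq_iff)
    have z0: "z \<noteq> 0" using z(1) \<open>2 * S0 powr \<alpha> > 0\<close> by auto
    define \<phi> where "\<phi> = Arg ?s"
    have \<phi>: "\<bar>\<phi>\<bar> < pi / 2" using Re_Ln_pos_lt[OF s0] s0 by (simp add: \<phi>_def Arg_eq_Im_Ln)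
    have w: "?s powr of_real \<alpha> = of_real (norm ?s powr \<alpha>) * cis (\<alpha> * \<phi>)"
      unfolding \<phi>_def by (rule powr_polar[OF s0])
    show "\<kappa> * norm ?s powr \<alpha> \<le> norm (?s powr of_real \<alpha> - z)"
    proof (cases "\<theta>3 \<le> \<bar>\<phi>\<bar>")
      case True
      define x where "x = \<alpha> * \<phi> - Arg z"
      have "\<bar>\<alpha> * \<phi>\<bar> = \<alpha> * \<bar>\<phi>\<bar>" using \<alpha> by (simp add: abs_mult)
      moreover have "\<alpha> * \<theta>3 \<le> \<alpha> * \<bar>\<phi>\<bar>" "\<alpha> * \<bar>\<phi>\<bar> \<le> \<alpha> * (pi / 2)"
        using True \<alpha> \<phi> by (auto intro!: mult_left_mono)
      ultimately have x: "d \<le> \<bar>x\<bar>" "\<bar>x\<bar> \<le> e" using z(2) by (auto simp: x_def d_def e_def mult.commute)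
      have "\<kappa> \<le> sin \<bar>x\<bar>" using sin_lower_between[OF d x e(1)] by (simp add: \<kappa>_def)
      also have "\<dots> \<le> \<bar>sin x\<bar>" by (cases "x \<ge> 0") auto
      finally have "\<kappa> * norm ?s powr \<alpha> \<le> \<bar>sin x\<bar> * norm ?s powr \<alpha>" by (intro mult_right_mono) auto
      also have "\<dots> = \<bar>Im ((?s powr of_real \<alpha> - z) * cis (- Arg z))\<bar>"
      proof -
        have "z * cis (- Arg z) = of_real (norm z) * (cis (Arg z) * cis (- Arg z))"
          using z0 by (metis mult.assoc rcis_cmod_Arg rcis_def)
        also have "\<dots> = of_real (norm z)" by (simp add: cis_mult)
        finally have "(?s powr of_real \<alpha> - z) * cis (- Arg z) = of_real (norm ?s powr \<alpha>) * cis x - of_real (norm z)"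
          unfolding w left_diff_distrib by (simp add: x_def cis_mult mult.assoc)
        then show ?thesis by (simp add: abs_mult)
      qed
      also have "\<dots> \<le> norm ((?s powr of_real \<alpha> - z) * cis (- Arg z))" by (rule abs_Im_le_cmod)
      finally show ?thesis by (simp add: norm_mult)
    next
      case False
      then have "cos \<theta>3 \<le> cos \<bar>\<phi>\<bar>" using \<theta>3 by (intro cos_monotone_0_pi_le) auto
      moreover have "Re ?s = norm ?s * cos \<phi>" unfolding \<phi>_def
        by (metis Re_rcis rcis_cmod_Arg)
      ultimately have "norm ?s * cos \<theta>3 \<le> 1"
        by (smt (verit) complex.sel(1) cos_abs_real mult_left_mono norm_ge_zero)
      then have "norm ?s \<le> S0" using cos3 by (simp add: S0_def field_simps)
      then have "norm ?s powr \<alpha> \<le> S0 powr \<alpha>" using \<alpha> by (intro powr_mono2) auto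
      moreover have "norm (?s powr of_real \<alpha>) = norm ?s powr \<alpha>" by (simp add: norm_powr_real_powr')
      ultimately have "norm ?s powr \<alpha> \<le> norm (?s powr of_real \<alpha> - z)"
        using z(1) norm_triangle_ineq2[of z "?s powr of_real \<alpha>"] by (simp add: norm_minus_commute)
      moreover have "\<kappa> * norm ?s powr \<alpha> \<le> 1 * norm ?s powr \<alpha>" by (intro mult_right_mono) (auto simp: \<kappa>_def)
      ultimately show ?thesis by simp
    qed
  qed
qed

lemma mittag_leffler_sector_asymptotics:
  assumes \<alpha>: "0 < \<alpha>" "\<alpha> \<le> 1" and \<theta>: "0 \<le> \<theta>" "\<theta> < pi * \<alpha> / 2"
  obtains C R where "C > 0" "R > 0"
    "\<And>z. R \<le> norm z \<Longrightarrow> \<bar>Arg z\<bar> \<le> \<theta> \<Longrightarrow>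
       norm (mittag_leffler \<alpha> 1 z - exp (z powr of_real (1 / \<alpha>)) / of_real \<alpha>) \<le> C * norm z"
proof -
  obtain \<kappa> R0 where \<kappa>: "\<kappa> > 0" "R0 > 0" and low: "\<And>z y. R0 \<le> norm z \<Longrightarrow> \<bar>Arg z\<bar> \<le> \<theta> \<Longrightarrow>
      \<kappa> * norm (Complex 1 y) powr \<alpha> \<le> norm (Complex 1 y powr of_real \<alpha> - z)"
    using resolvent_lower_bound[OF \<alpha> \<theta>] by metis
  have "\<theta> / \<alpha> < pi / 2" using \<alpha> \<theta> by (simp add: field_simps)
  moreover have "\<theta> / \<alpha> \<ge> 0" using \<alpha> \<theta> by simp
  ultimately have cos: "cos (\<theta> / \<alpha>) > 0" by (intro cos_gt_zero_pi) auto
  define W where "W = (LBINT y. norm (Complex 1 y) powr (- (\<alpha> + 1)))"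
  have "W \<ge> 0" unfolding W_def by (intro integral_nonneg_AE) auto
  define C where "C = 1 + exp 1 / \<kappa> * W / (2 * pi)"
  define R where "R = max (max R0 1) ((2 / cos (\<theta> / \<alpha>)) powr \<alpha>)"
  show ?thesis
  proof
    show "C > 0" using \<open>W \<ge> 0\<close> \<kappa> by (simp add: C_def add_pos_nonneg)
    show "R > 0" by (simp add: R_def)
    fix z assume z: "R \<le> norm z" "\<bar>Arg z\<bar> \<le> \<theta>"
    have z0: "z \<noteq> 0" and z1: "1 \<le> norm z" using z(1) by (auto simp: R_def)
    have "\<bar>Arg z / \<alpha>\<bar> \<le> \<theta> / \<alpha>" using z \<alpha> by (simp add: divide_right_mono)
    then have "cos (\<theta> / \<alpha>) \<le> cos \<bar>Arg z / \<alpha>\<bar>" using \<open>\<theta> / \<alpha> < pi / 2\<close> pi_gt_zero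
      by (intro cos_monotone_0_pi_le) linarith+
    then have "cos (\<theta> / \<alpha>) \<le> cos (Arg z / \<alpha>)" by (simp only: cos_abs_real)
    moreover have "2 / cos (\<theta> / \<alpha>) \<le> norm z powr (1 / \<alpha>)"
    proof -
      have "2 / cos (\<theta> / \<alpha>) = ((2 / cos (\<theta> / \<alpha>)) powr \<alpha>) powr (1 / \<alpha>)" using \<alpha> cos by (simp add: powr_powr)
      also have "\<dots> \<le> norm z powr (1 / \<alpha>)" using z \<alpha> by (intro powr_mono2) (auto simp: R_def)
      finally show ?thesis .
    qed
    ultimately have "(2 / cos (\<theta> / \<alpha>)) * cos (\<theta> / \<alpha>) \<le> norm z powr (1 / \<alpha>) * cos (Arg z / \<alpha>)"
      using cos by (intro mult_mono) auto
    then have Re: "1 < Re (z powr of_real (1 / \<alpha>))"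
      using cos unfolding powr_polar[OF z0] by simp
    have bound: "norm (LBINT y. exp (Complex 1 y) * z / (Complex 1 y * (Complex 1 y powr of_real \<alpha> - z)))
       \<le> (LBINT y. norm z * exp 1 / \<kappa> * norm (Complex 1 y) powr (- (\<alpha> + 1)))"
    proof (rule norm_integral_le)
      show "integrable lborel (\<lambda>y. norm z * exp 1 / \<kappa> * norm (Complex 1 y) powr - (\<alpha> + 1))"
        using \<alpha> by (intro integrable_mult_right integrable_line_powr) auto
      fix y
      have s: "0 < norm (Complex 1 y)" by (simp add: complex_eq_iff)
      have "norm (exp (Complex 1 y) * z / (Complex 1 y * (Complex 1 y powr of_real \<alpha> - z)))
         = exp 1 * norm z / (norm (Complex 1 y) * norm (Complex 1 y powr of_real \<alpha> - z))"
        by (simp add: norm_mult norm_divide)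
      also have "\<dots> \<le> exp 1 * norm z / (norm (Complex 1 y) * (\<kappa> * norm (Complex 1 y) powr \<alpha>))"
      proof -
        have "0 < \<kappa> * norm (Complex 1 y) powr \<alpha>" using \<kappa> s by simp
        moreover have "\<kappa> * norm (Complex 1 y) powr \<alpha> \<le> norm (Complex 1 y powr of_real \<alpha> - z)"
          using z by (intro low) (auto simp: R_def)
        moreover from calculation have "0 < norm (Complex 1 y powr of_real \<alpha> - z)" by linarith
        ultimately show ?thesis
          using s \<kappa> by (intro divide_left_mono mult_left_mono mult_pos_pos) auto
      qed
      also have "\<dots> = norm z * exp 1 / \<kappa> * norm (Complex 1 y) powr (- (\<alpha> + 1))"
        unfolding powr_minus_Suc_eq[OF s] using \<kappa> by (simp add: field_simps)
      finally show "norm (exp (Complex 1 y) * z / (Complex 1 y * (Complex 1 y powr of_real \<alpha> - z)))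
        \<le> norm z * exp 1 / \<kappa> * norm (Complex 1 y) powr (- (\<alpha> + 1))" .
    qed
    let ?I = "LBINT y. exp (Complex 1 y) * z / (Complex 1 y * (Complex 1 y powr of_real \<alpha> - z))"
    have "mittag_leffler \<alpha> 1 z - exp (z powr of_real (1 / \<alpha>)) / of_real \<alpha> = 1 + ?I / (2 * pi)"
      using mittag_leffler_shifted_line[OF \<alpha> zero_less_one z0 Re] z \<theta> by simp
    also have "norm \<dots> \<le> norm (1::complex) + norm (?I / (2 * pi))" by (rule norm_triangle_ineq)
    also have "\<dots> = 1 + norm ?I / (2 * pi)" by (simp add: norm_divide)
    also have "\<dots> \<le> norm z + (norm z * exp 1 / \<kappa> * W) / (2 * pi)"
      using bound z1 by (intro add_mono divide_right_mono) (auto simp: W_def)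
    also have "\<dots> = C * norm z" by (simp add: C_def algebra_simps)
    finally show "norm (mittag_leffler \<alpha> 1 z - exp (z powr of_real (1 / \<alpha>)) / of_real \<alpha>) \<le> C * norm z" .
  qed
qed

text \<open>The estimate for the derivative is Cauchy's inequality for the remainder, on the disc of radius
  \<open>\<kappa>r\<close> around \<open>r\<zeta>\<close>; for small \<open>\<kappa>\<close> this disc lies in a slightly larger sector at every scale \<open>r\<close>.
  The remainder is \<open>O(r)\<close> there, hence its derivative is bounded.\<close>

lemma mittag_leffler_ray_deriv_asymptotics:
  assumes \<alpha>: "0 < \<alpha>" "\<alpha> \<le> 1" and \<zeta>: "norm \<zeta> = 1" "\<bar>Arg \<zeta>\<bar> < pi * \<alpha> / 2"
  obtains C R where "C > 0" "R > 0"
    "\<And>r. R \<le> r \<Longrightarrow> norm (mittag_leffler \<alpha> 1 (of_real r * \<zeta>)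
        - exp ((of_real r * \<zeta>) powr of_real (1 / \<alpha>)) / of_real \<alpha>) \<le> C * r"
    "\<And>r. R \<le> r \<Longrightarrow> norm (deriv (mittag_leffler \<alpha> 1) (of_real r * \<zeta>)
        - (of_real r * \<zeta>) powr (of_real (1 / \<alpha>) - 1) * exp ((of_real r * \<zeta>) powr of_real (1 / \<alpha>)) / of_real (\<alpha>\<^sup>2)) \<le> C"
proof -
  define \<theta> where "\<theta> = (\<bar>Arg \<zeta>\<bar> + pi * \<alpha> / 2) / 2"
  have "0 < pi * \<alpha> / 2" using \<alpha> by simp
  then have \<theta>: "0 \<le> \<theta>" "\<theta> < pi * \<alpha> / 2" "\<bar>Arg \<zeta>\<bar> < \<theta>" 
    using \<zeta>(2) abs_ge_zero[of "Arg \<zeta>"] unfolding \<theta>_def by (simp_all add: field_simps)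
  have "pi * \<alpha> \<le> pi" using \<alpha> by simp
  then have "\<theta> < pi" using \<theta> pi_gt_zero by linarith
  obtain C R where C: "C > 0" "R > 0" and bound: "\<And>z. R \<le> norm z \<Longrightarrow> \<bar>Arg z\<bar> \<le> \<theta> \<Longrightarrow>
       norm (mittag_leffler \<alpha> 1 z - exp (z powr of_real (1 / \<alpha>)) / of_real \<alpha>) \<le> C * norm z"
    using mittag_leffler_sector_asymptotics[OF \<alpha> \<theta>(1,2)] by metis
  define D where "D = (\<lambda>z. mittag_leffler \<alpha> 1 z - exp (z powr of_real (1 / \<alpha>)) / of_real \<alpha>)"
  have \<zeta>0: "\<zeta> \<noteq> 0" using \<zeta> by auto
  have slit: "z \<notin> \<real>\<^sub>\<le>\<^sub>0" if "z \<noteq> 0" "\<bar>Arg z\<bar> \<le> \<theta>" for z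
  proof
    assume "z \<in> \<real>\<^sub>\<le>\<^sub>0"
    then obtain x where "z = of_real x" "x \<le> 0" by (auto elim: nonpos_Reals_cases)
    then have "Arg z = pi" using that(1) by (simp add: Arg_of_real)
    then show False using that(2) \<open>\<theta> < pi\<close> by simp
  qed
  obtain \<kappa> where \<kappa>: "0 < \<kappa>" "\<kappa> \<le> 1 / 2" and cone: "\<And>v. dist v \<zeta> \<le> \<kappa> \<Longrightarrow> \<bar>Arg v\<bar> \<le> \<theta>"
  proof -
    have "isCont Arg \<zeta>" using slit[OF \<zeta>0] \<theta> by (intro continuous_at_Arg) auto
    then obtain d where "d > 0" and d: "\<And>v. dist v \<zeta> < d \<Longrightarrow> dist (Arg v) (Arg \<zeta>) < \<theta> - \<bar>Arg \<zeta>\<bar>"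
      using \<theta>(3) unfolding continuous_at_eps_delta by (metis diff_gt_0_iff_gt)
    show ?thesis
    proof (rule that[of "min (d / 2) (1 / 2)"])
      fix v assume "dist v \<zeta> \<le> min (d / 2) (1 / 2)"
      then have "dist v \<zeta> < d" using \<open>d > 0\<close> by auto
      from d[OF this] show "\<bar>Arg v\<bar> \<le> \<theta>" by (auto simp: dist_real_def)
    qed (use \<open>d > 0\<close> in auto)
  qed
  have disc: "w \<noteq> 0 \<and> \<bar>Arg w\<bar> \<le> \<theta> \<and> r / 2 \<le> norm w \<and> norm w \<le> 2 * r"
    if r: "r > 0" and w: "w \<in> cball (of_real r * \<zeta>) (r * \<kappa>)" for r w
  proof -
    define v where "v = w / of_real r"
    have wv: "w = of_real r * v" using r by (simp add: v_def)
    have "dist w (of_real r * \<zeta>) = r * dist v \<zeta>"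
      using r unfolding wv dist_norm by (simp add: norm_mult flip: right_diff_distrib)
    then have v: "dist v \<zeta> \<le> \<kappa>" using w r by (simp add: dist_commute)
    then have "1 / 2 \<le> norm v" "norm v \<le> 2"
      using \<kappa> \<zeta> norm_triangle_ineq2[of \<zeta> v] norm_triangle_ineq2[of v \<zeta>] by (auto simp: dist_norm norm_minus_commute)
    then show ?thesis using cone[OF v] r by (auto simp: wv norm_mult)
  qed
  have exp_deriv: "((\<lambda>z. exp (z powr of_real (1 / \<alpha>)) / of_real \<alpha>) has_field_derivative
      z powr (of_real (1 / \<alpha>) - 1) * exp (z powr of_real (1 / \<alpha>)) / of_real (\<alpha>\<^sup>2)) (at z)"
    if "z \<notin> \<real>\<^sub>\<le>\<^sub>0" for z :: complex
  proof -
    note DERIV_cdivide[OF DERIV_chain2[OF DERIV_exp has_field_derivative_powr[OF that, of "of_real (1 / \<alpha>)"]], of "of_real \<alpha>"]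
    moreover have "exp (z powr of_real (1 / \<alpha>)) * (of_real (1 / \<alpha>) * z powr (of_real (1 / \<alpha>) - 1)) / of_real \<alpha>
      = z powr (of_real (1 / \<alpha>) - 1) * exp (z powr of_real (1 / \<alpha>)) / of_real (\<alpha>\<^sup>2)"
      using \<alpha> by (simp add: power2_eq_square)
    ultimately show ?thesis by (simp only:)
  qed
  have D_deriv: "(D has_field_derivative (deriv (mittag_leffler \<alpha> 1) z
      - z powr (of_real (1 / \<alpha>) - 1) * exp (z powr of_real (1 / \<alpha>)) / of_real (\<alpha>\<^sup>2))) (at z)"
    if "z \<notin> \<real>\<^sub>\<le>\<^sub>0" for z
    unfolding D_def
    by (intro DERIV_diff exp_deriv[OF that] holomorphic_derivI[OF mittag_leffler_holomorphic[OF \<alpha>(1), of UNIV]]) auto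
  show ?thesis
  proof (rule that[of "max C (C * 2 / \<kappa>)" "2 * R"])
    fix r assume "2 * R \<le> r"
    then have r: "r > 0" "R \<le> r / 2" using C by auto
    have norm_D: "norm (D w) \<le> C * norm w" if "w \<in> cball (of_real r * \<zeta>) (r * \<kappa>)" for w
      unfolding D_def using disc[OF r(1) that] r by (intro bound) auto
    have center: "of_real r * \<zeta> \<in> cball (of_real r * \<zeta>) (r * \<kappa>)" using r \<kappa> by simp
    have "norm (D (of_real r * \<zeta>)) \<le> C * r" using norm_D[OF center] r \<zeta> by (simp add: norm_mult)
    also have "\<dots> \<le> max C (C * 2 / \<kappa>) * r" using r by (intro mult_right_mono) auto
    finally show "norm (mittag_leffler \<alpha> 1 (of_real r * \<zeta>)
        - exp ((of_real r * \<zeta>) powr of_real (1 / \<alpha>)) / of_real \<alpha>) \<le> max C (C * 2 / \<kappa>) * r"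
      by (simp add: D_def)
    have hol: "D holomorphic_on cball (of_real r * \<zeta>) (r * \<kappa>)"
      unfolding holomorphic_on_def field_differentiable_def
      using D_deriv slit disc[OF r(1)] has_field_derivative_at_within by blast
    have "norm ((deriv ^^ 1) D (of_real r * \<zeta>)) \<le> fact 1 * (C * (2 * r)) / (r * \<kappa>) ^ 1"
    proof (rule Cauchy_inequality)
      show "D holomorphic_on ball (of_real r * \<zeta>) (r * \<kappa>)"
        using hol ball_subset_cball holomorphic_on_subset by blast
      show "continuous_on (cball (of_real r * \<zeta>) (r * \<kappa>)) D" by (rule holomorphic_on_imp_continuous_on[OF hol])
      fix w assume "norm (of_real r * \<zeta> - w) = r * \<kappa>"
      then have w: "w \<in> cball (of_real r * \<zeta>) (r * \<kappa>)" by (simp add: dist_norm)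
      have "C * norm w \<le> C * (2 * r)" using disc[OF r(1) w] C by (intro mult_left_mono) auto
      then show "norm (D w) \<le> C * (2 * r)" using norm_D[OF w] by simp
    qed (use r \<kappa> in simp)
    also have "\<dots> = C * 2 / \<kappa>" using r by simp
    also have "\<dots> \<le> max C (C * 2 / \<kappa>)" by simp
    finally have "norm (deriv D (of_real r * \<zeta>)) \<le> max C (C * 2 / \<kappa>)" by simp
    moreover have "deriv D (of_real r * \<zeta>) = deriv (mittag_leffler \<alpha> 1) (of_real r * \<zeta>)
        - (of_real r * \<zeta>) powr (of_real (1 / \<alpha>) - 1) * exp ((of_real r * \<zeta>) powr of_real (1 / \<alpha>)) / of_real (\<alpha>\<^sup>2)"
      using disc[OF r(1) center] by (intro DERIV_imp_deriv D_deriv slit) auto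
    ultimately show "norm (deriv (mittag_leffler \<alpha> 1) (of_real r * \<zeta>)
        - (of_real r * \<zeta>) powr (of_real (1 / \<alpha>) - 1) * exp ((of_real r * \<zeta>) powr of_real (1 / \<alpha>)) / of_real (\<alpha>\<^sup>2)) \<le> max C (C * 2 / \<kappa>)"
      by (simp only:)
  qed (use C in auto)
qed

lemma cos_divide_pos:
  fixes \<alpha> \<phi> :: real
  assumes "0 < \<alpha>" "\<bar>\<phi>\<bar> < pi * \<alpha> / 2"
  shows "0 < cos (\<phi> / \<alpha>)"
proof -
  have "\<bar>\<phi> / \<alpha>\<bar> < pi / 2" using assms by (simp add: field_simps)
  then show ?thesis by (intro cos_gt_zero_pi) (simp_all only: abs_less_iff, linarith+)
qed

text \<open>The remainders of the asymptotics are absorbed into the exponential, because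
  \<open>r \<le> r\<^sup>1\<^sup>/\<^sup>\<alpha>\<close> for \<open>r \<ge> 1\<close>; for small \<open>r\<close> the entire functions \<open>E\<close> and \<open>E'\<close> are bounded.\<close>

lemma mittag_leffler_ray_bounds:
  assumes \<alpha>: "0 < \<alpha>" "\<alpha> \<le> 1" and \<zeta>: "norm \<zeta> = 1" "\<bar>Arg \<zeta>\<bar> < pi * \<alpha> / 2"
  defines "c \<equiv> cos (Arg \<zeta> / \<alpha>)"
  obtains C k R where "C > 0" "k > 0" "R > 0"
    "\<And>r. 0 \<le> r \<Longrightarrow> norm (mittag_leffler \<alpha> 1 (of_real r * \<zeta>)) \<le> C * exp (c * r powr (1 / \<alpha>))"
    "\<And>r. 0 \<le> r \<Longrightarrow> norm (deriv (mittag_leffler \<alpha> 1) (of_real r * \<zeta>))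
        \<le> C * (1 + r powr (1 / \<alpha> - 1)) * exp (c * r powr (1 / \<alpha>))"
    "\<And>r. R \<le> r \<Longrightarrow> k * r powr (1 / \<alpha> - 1) * exp (c * r powr (1 / \<alpha>))
        \<le> norm (deriv (mittag_leffler \<alpha> 1) (of_real r * \<zeta>))"
proof -
  have c: "c > 0" unfolding c_def by (rule cos_divide_pos[OF \<alpha>(1) \<zeta>(2)])
  let ?E = "mittag_leffler \<alpha> 1"
  obtain C0 R0 where C0: "C0 > 0" "R0 > 0" and
    E: "\<And>r. R0 \<le> r \<Longrightarrow> norm (?E (of_real r * \<zeta>)
        - exp ((of_real r * \<zeta>) powr of_real (1 / \<alpha>)) / of_real \<alpha>) \<le> C0 * r" and
    E': "\<And>r. R0 \<le> r \<Longrightarrow> norm (deriv ?E (of_real r * \<zeta>)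
        - (of_real r * \<zeta>) powr (of_real (1 / \<alpha>) - 1) * exp ((of_real r * \<zeta>) powr of_real (1 / \<alpha>)) / of_real (\<alpha>\<^sup>2)) \<le> C0"
    using mittag_leffler_ray_deriv_asymptotics[OF \<alpha> \<zeta>] by metis
  have \<zeta>0: "\<zeta> \<noteq> 0" using \<zeta> by auto
  have norm_exp: "norm (exp ((of_real r * \<zeta>) powr of_real (1 / \<alpha>))) = exp (c * r powr (1 / \<alpha>))" if "r > 0" for r
    using that \<zeta> \<zeta>0 by (subst powr_polar) (auto simp: norm_mult c_def mult.commute)
  have norm_powr: "norm ((of_real r * \<zeta>) powr (of_real (1 / \<alpha>) - 1)) = r powr (1 / \<alpha> - 1)" if "r > 0" for r
    using norm_powr_real_powr'[of "of_real (1 / \<alpha>) - 1" "of_real r * \<zeta>"] that \<zeta> by (simp add: norm_mult)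
  define R where "R = max R0 1"
  have "compact ((\<lambda>r. complex_of_real r * \<zeta>) ` {0..R})"
    by (intro compact_continuous_image continuous_intros) auto
  then have cpt: "\<exists>M. \<forall>r\<in>{0..R}. norm (g (of_real r * \<zeta>)) \<le> M" if "g holomorphic_on UNIV" for g :: "complex \<Rightarrow> complex"
    using compact_imp_bounded[OF compact_continuous_image[OF continuous_on_subset[OF holomorphic_on_imp_continuous_on[OF that]]]]
    unfolding bounded_iff by fastforce
  obtain M0 where M0: "\<And>r. r \<in> {0..R} \<Longrightarrow> norm (?E (of_real r * \<zeta>)) \<le> M0"
    using cpt[OF mittag_leffler_holomorphic[OF \<alpha>(1)]] by blast
  obtain M1 where M1: "\<And>r. r \<in> {0..R} \<Longrightarrow> norm (deriv ?E (of_real r * \<zeta>)) \<le> M1"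
    using cpt[OF holomorphic_deriv[OF mittag_leffler_holomorphic[OF \<alpha>(1)] open_UNIV]] by blast
  define C where "C = max (max (1 / \<alpha> + C0 / c) (1 / \<alpha>\<^sup>2 + C0)) (max M0 M1)"
  have C_ge: "1 / \<alpha> + C0 / c \<le> C" "1 / \<alpha>\<^sup>2 + C0 \<le> C" "M0 \<le> C" "M1 \<le> C" by (auto simp: C_def)
  have "C > 0" using C_ge(1) \<alpha> C0 c by (smt (verit) divide_pos_pos)
  have growth: "r * c \<le> exp (c * r powr (1 / \<alpha>))" "1 \<le> exp (c * r powr (1 / \<alpha>))" if "r \<ge> 1" for r
  proof -
    have "r powr 1 \<le> r powr (1 / \<alpha>)" using that \<alpha> by (intro powr_mono) auto
    then have "c * r \<le> c * r powr (1 / \<alpha>)" using c that by simp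
    then show "r * c \<le> exp (c * r powr (1 / \<alpha>))"
      using exp_ge_add_one_self[of "c * r powr (1 / \<alpha>)"] mult.commute[of r c] by linarith
    show "1 \<le> exp (c * r powr (1 / \<alpha>))" using c by simp
  qed
  obtain R1 where R1: "\<And>r. R1 \<le> r \<Longrightarrow> 2 * \<alpha>\<^sup>2 * C0 \<le> r * c"
    using c by (metis divide_le_eq)
  show ?thesis
  proof (rule that[of C "1 / (2 * \<alpha>\<^sup>2)" "max R R1"])
    fix r :: real assume r: "0 \<le> r"
    show "norm (?E (of_real r * \<zeta>)) \<le> C * exp (c * r powr (1 / \<alpha>))"
    proof (cases "r \<le> R")
      case True
      have "norm (?E (of_real r * \<zeta>)) \<le> C * 1" using M0[of r] True r C_ge by simp
      also have "\<dots> \<le> C * exp (c * r powr (1 / \<alpha>))" using \<open>C > 0\<close> c by (intro mult_left_mono) auto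
      finally show ?thesis .
    next
      case False
      then have r: "r \<ge> 1" "r > 0" "R0 \<le> r" by (auto simp: R_def)
      have "norm (?E (of_real r * \<zeta>)) \<le> norm (exp ((of_real r * \<zeta>) powr of_real (1 / \<alpha>)) / of_real \<alpha>) + C0 * r"
        using E[OF r(3)] norm_triangle_ineq2[of "?E (of_real r * \<zeta>)" "exp ((of_real r * \<zeta>) powr of_real (1 / \<alpha>)) / of_real \<alpha>"] by simp
      also have "\<dots> = exp (c * r powr (1 / \<alpha>)) / \<alpha> + C0 / c * (r * c)"
        unfolding norm_divide norm_exp[OF r(2)] using \<alpha> c by simp
      also have "\<dots> \<le> exp (c * r powr (1 / \<alpha>)) / \<alpha> + C0 / c * exp (c * r powr (1 / \<alpha>))"
        using growth[OF r(1)] C0 c by (intro add_left_mono mult_left_mono) auto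
      also have "\<dots> = (1 / \<alpha> + C0 / c) * exp (c * r powr (1 / \<alpha>))" by (simp add: algebra_simps)
      also have "\<dots> \<le> C * exp (c * r powr (1 / \<alpha>))" using C_ge by (intro mult_right_mono) auto
      finally show ?thesis .
    qed
    show "norm (deriv ?E (of_real r * \<zeta>)) \<le> C * (1 + r powr (1 / \<alpha> - 1)) * exp (c * r powr (1 / \<alpha>))"
    proof (cases "r \<le> R")
      case True
      have "norm (deriv ?E (of_real r * \<zeta>)) \<le> C * 1 * 1" using M1[of r] True r C_ge by simp
      also have "\<dots> \<le> C * (1 + r powr (1 / \<alpha> - 1)) * exp (c * r powr (1 / \<alpha>))"
        using \<open>C > 0\<close> c by (intro mult_mono) auto
      finally show ?thesis .
    next
      case False
      then have r: "r \<ge> 1" "r > 0" "R0 \<le> r" by (auto simp: R_def)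
      let ?X = "exp (c * r powr (1 / \<alpha>))" and ?Y = "r powr (1 / \<alpha> - 1)"
      have "norm (deriv ?E (of_real r * \<zeta>)) \<le> norm ((of_real r * \<zeta>) powr (of_real (1 / \<alpha>) - 1) * exp ((of_real r * \<zeta>) powr of_real (1 / \<alpha>)) / of_real (\<alpha>\<^sup>2)) + C0"
        using E'[OF r(3)] norm_triangle_ineq2[of "deriv ?E (of_real r * \<zeta>)" "(of_real r * \<zeta>) powr (of_real (1 / \<alpha>) - 1) * exp ((of_real r * \<zeta>) powr of_real (1 / \<alpha>)) / of_real (\<alpha>\<^sup>2)"] by simp
      also have "\<dots> = ?Y * ?X * (1 / \<alpha>\<^sup>2) + C0 * 1"
        unfolding norm_divide norm_mult norm_exp[OF r(2)] norm_powr[OF r(2)] by (simp add: norm_power)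
      also have "\<dots> \<le> ((1 + ?Y) * ?X) * (1 / \<alpha>\<^sup>2) + C0 * ((1 + ?Y) * ?X)"
      proof -
        have "1 * 1 \<le> (1 + ?Y) * ?X" using growth(2)[OF r(1)] by (intro mult_mono) auto
        then show ?thesis using C0 by (intro add_mono mult_right_mono mult_left_mono) auto
      qed
      also have "\<dots> = (1 / \<alpha>\<^sup>2 + C0) * ((1 + ?Y) * ?X)" by (simp only: distrib_right mult.commute)
      also have "\<dots> \<le> C * ((1 + ?Y) * ?X)" using C_ge by (intro mult_right_mono) auto
      finally show ?thesis by (simp only: mult.assoc)
    qed
  next
    fix r assume "max R R1 \<le> r"
    then have r: "r \<ge> 1" "r > 0" "R0 \<le> r" "R1 \<le> r" by (auto simp: R_def)
    let ?X = "exp (c * r powr (1 / \<alpha>))" and ?Y = "r powr (1 / \<alpha> - 1)"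
    have Y: "?Y \<ge> 1" using r \<alpha> by (intro ge_one_powr_ge_zero) auto
    have "2 * \<alpha>\<^sup>2 * C0 \<le> ?X" using R1[OF r(4)] growth(1)[OF r(1)] by simp
    also have "\<dots> \<le> ?Y * ?X" using Y by simp
    finally have "C0 \<le> ?Y * ?X / (2 * \<alpha>\<^sup>2)" using \<alpha> by (simp add: field_simps)
    moreover have "?Y * ?X / \<alpha>\<^sup>2 - C0 \<le> norm (deriv ?E (of_real r * \<zeta>))"
    proof -
      have "norm ((of_real r * \<zeta>) powr (of_real (1 / \<alpha>) - 1) * exp ((of_real r * \<zeta>) powr of_real (1 / \<alpha>)) / of_real (\<alpha>\<^sup>2)) = ?Y * ?X / \<alpha>\<^sup>2"
        unfolding norm_divide norm_mult norm_exp[OF r(2)] norm_powr[OF r(2)] by (simp add: norm_power)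
      then show ?thesis
        using E'[OF r(3)] norm_triangle_ineq3[of "deriv ?E (of_real r * \<zeta>)" "(of_real r * \<zeta>) powr (of_real (1 / \<alpha>) - 1) * exp ((of_real r * \<zeta>) powr of_real (1 / \<alpha>)) / of_real (\<alpha>\<^sup>2)"] by linarith
    qed
    moreover have "?Y * ?X / \<alpha>\<^sup>2 = 2 * (?Y * ?X / (2 * \<alpha>\<^sup>2))" by simp
    ultimately have "?Y * ?X / (2 * \<alpha>\<^sup>2) \<le> norm (deriv ?E (of_real r * \<zeta>))" by linarith
    then show "1 / (2 * \<alpha>\<^sup>2) * ?Y * ?X \<le> norm (deriv ?E (of_real r * \<zeta>))" by simp
  qed (use \<open>C > 0\<close> \<alpha> C0 in \<open>auto simp: R_def\<close>)
qed

section \<open>Gradients of radial multipliers and the upper bound\<close>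

lemma norm_vec_mult_left:
  fixes v :: "complex^'d"
  shows "norm (\<chi> j. a * v $ j) = norm a * norm v"
  by (simp add: norm_vec_def norm_mult L2_set_right_distrib)

lemma norm_vec_of_real:
  fixes \<xi> :: "real^'d"
  shows "norm (\<chi> j. a * complex_of_real (\<xi> $ j)) = norm a * norm \<xi>"
  by (simp add: norm_vec_def norm_mult L2_set_right_distrib)

lemma gradient_radial_multiplier:
  fixes g :: "real^'d \<Rightarrow> complex" and \<xi> :: "real^'d" and \<zeta> :: complex and T :: real
  assumes E: "E holomorphic_on UNIV" and g: "g differentiable (at \<xi>)"
  defines "z \<equiv> \<zeta> * of_real ((norm \<xi>)\<^sup>2 * T)"
  shows "gradient (\<lambda>\<eta>. E (\<zeta> * of_real ((norm \<eta>)\<^sup>2 * T)) * g \<eta>) \<xi>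
    = (\<chi> j. (deriv E z * \<zeta> * of_real (2 * T) * g \<xi>) * of_real (\<xi> $ j)) + (\<chi> j. E z * gradient g \<xi> $ j)"
proof -
  let ?z = "\<lambda>\<eta>::real^'d. \<zeta> * of_real ((norm \<eta>)\<^sup>2 * T)"
  have z: "(?z has_derivative (\<lambda>h. \<zeta> * of_real (2 * (\<xi> \<bullet> h) * T))) (at \<xi>)"
    unfolding power2_norm_eq_inner
    by (auto intro!: derivative_eq_intros simp: inner_commute algebra_simps fun_eq_iff)
  have dE: "(E has_field_derivative deriv E z) (at (?z \<xi>))"
    unfolding z_def by (rule holomorphic_derivI[OF E]) auto
  have 1: "((\<lambda>\<eta>. E (?z \<eta>)) has_derivative (\<lambda>h. deriv E z * (\<zeta> * of_real (2 * (\<xi> \<bullet> h) * T)))) (at \<xi>)"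
    using has_derivative_compose[OF z has_field_derivative_imp_has_derivative[OF dE]] by simp
  have 2: "(g has_derivative frechet_derivative g (at \<xi>)) (at \<xi>)" using g by (simp add: frechet_derivative_works)
  have "((\<lambda>\<eta>. E (?z \<eta>) * g \<eta>) has_derivative
     (\<lambda>h. E (?z \<xi>) * frechet_derivative g (at \<xi>) h + deriv E z * (\<zeta> * of_real (2 * (\<xi> \<bullet> h) * T)) * g \<xi>)) (at \<xi>)"
    by (rule has_derivative_mult[OF 1 2])
  from frechet_derivative_at[OF this, symmetric]
  show ?thesis
    by (simp add: vec_eq_iff gradient_def dir_deriv_def inner_axis z_def algebra_simps)
qed

text \<open>The continuous first derivatives have compact support, hence are bounded; a bounded derivative
  gives the Lipschitz bound.\<close>

lemma C1_compact_support:
  fixes g :: "real^'d \<Rightarrow> complex"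
  assumes g: "C_k 1 g" and cpt: "compact (supp g)"
  obtains M where "M > 0" "\<And>\<xi>. norm (gradient g \<xi>) \<le> M" "\<And>\<xi> \<eta>. norm (g \<xi> - g \<eta>) \<le> M * norm (\<xi> - \<eta>)"
    "continuous_on UNIV (gradient g)" "\<And>\<xi>. \<xi> \<notin> supp g \<Longrightarrow> gradient g \<xi> = 0"
proof -
  have diff: "g differentiable (at \<xi>)" for \<xi> using g by simp
  have cont: "continuous_on UNIV (dir_deriv b g)" if "b \<in> Basis" for b using g that by simp
  have zero: "frechet_derivative g (at \<xi>) = (\<lambda>_. 0)" if "\<xi> \<notin> supp g" for \<xi>
  proof -
    have "(g has_derivative (\<lambda>_. 0)) (at \<xi>)"
    proof (rule has_derivative_transform_within_open)
      show "((\<lambda>_. 0) has_derivative (\<lambda>_. 0)) (at \<xi>)" by simp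
      show "open (- supp g)" unfolding supp_def by auto
      show "\<xi> \<in> - supp g" using that by simp
      show "0 = g x" if "x \<in> - supp g" for x using that closure_subset[of "{x. g x \<noteq> 0}"] by (auto simp: supp_def)
    qed
    from frechet_derivative_at[OF this] show ?thesis by simp
  qed
  have grad_cont: "continuous_on UNIV (gradient g)"
    unfolding gradient_def by (intro continuous_on_vec_lambda cont) (simp add: axis_in_Basis_iff)
  have "\<exists>M. \<forall>\<xi>. norm (dir_deriv b g \<xi>) \<le> M" if b: "b \<in> Basis" for b :: "real^'d"
  proof -
    obtain M where M: "\<And>\<xi>. \<xi> \<in> supp g \<Longrightarrow> norm (dir_deriv b g \<xi>) \<le> M"
      using compact_imp_bounded[OF compact_continuous_image[OF continuous_on_subset[OF cont[OF b] subset_UNIV] cpt]]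
      unfolding bounded_iff by auto
    have "norm (dir_deriv b g \<xi>) \<le> max M 0" for \<xi>
      using M[of \<xi>] zero[of \<xi>] by (cases "\<xi> \<in> supp g") (auto simp: dir_deriv_def)
    then show ?thesis by blast
  qed
  then obtain m where m: "\<And>b \<xi>. b \<in> Basis \<Longrightarrow> norm (dir_deriv b g \<xi>) \<le> m b" by metis
  define M where "M = (\<Sum>b\<in>Basis. m b) + 1"
  have m0: "m b \<ge> 0" if "b \<in> Basis" for b using m[OF that, of 0] norm_ge_zero order_trans by blast
  have M0: "M > 0" using m0 by (simp add: M_def add_nonneg_pos sum_nonneg)
  show ?thesis
  proof (rule that[OF M0])
    show "norm (gradient g \<xi>) \<le> M" for \<xi>
    proof -
      have "norm (gradient g \<xi>) \<le> (\<Sum>j\<in>UNIV. norm (gradient g \<xi> $ j))"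
        by (simp add: norm_vec_def L2_set_le_sum)
      also have "\<dots> \<le> (\<Sum>j\<in>(UNIV::'d set). m (axis j 1))"
        unfolding gradient_def by (intro sum_mono) (simp add: m axis_in_Basis_iff)
      also have "\<dots> = (\<Sum>b\<in>(Basis :: (real^'d) set). m b)"
      proof -
        have B: "(Basis :: (real^'d) set) = range (\<lambda>j. axis j 1)" by (auto simp: Basis_vec_def)
        have "inj (\<lambda>j::'d. axis j (1::real))" by (auto simp: inj_on_def axis_eq_axis)
        from sum.reindex[OF this, of m] show ?thesis unfolding B by (simp add: o_def)
      qed
      finally show ?thesis by (simp add: M_def)
    qed
    show "norm (g \<xi> - g \<eta>) \<le> M * norm (\<xi> - \<eta>)" for \<xi> \<eta>
    proof (rule differentiable_bound[OF convex_UNIV, of g "\<lambda>x. frechet_derivative g (at x)"])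
      fix x :: "real^'d"
      have D: "(g has_derivative frechet_derivative g (at x)) (at x)" using diff by (simp add: frechet_derivative_works)
      then show "(g has_derivative frechet_derivative g (at x)) (at x within UNIV)" by simp
      interpret bounded_linear "frechet_derivative g (at x)" using D by (rule has_derivative_bounded_linear)
      show "onorm (frechet_derivative g (at x)) \<le> M"
      proof (rule onorm_le)
        fix h :: "real^'d"
        have "frechet_derivative g (at x) h = (\<Sum>b\<in>Basis. (h \<bullet> b) *\<^sub>R dir_deriv b g x)"
          by (subst euclidean_representation[symmetric, of h]) (simp only: sum scaleR dir_deriv_def)
        also have "norm \<dots> \<le> (\<Sum>b\<in>Basis. norm h * m b)"
          by (rule sum_norm_le) (auto simp: Basis_le_norm m intro!: mult_mono)
        also have "\<dots> \<le> M * norm h" by (simp add: M_def sum_distrib_left[symmetric] algebra_simps)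
        finally show "norm (frechet_derivative g (at x) h) \<le> M * norm h" .
      qed
    qed auto
    show "gradient g \<xi> = 0" if "\<xi> \<notin> supp g" for \<xi>
      using zero[OF that] by (simp add: gradient_def dir_deriv_def vec_eq_iff)
  qed (rule grad_cont)
qed

lemma mean_square_displacement_eq:
  "mean_square_displacement w = (\<integral>\<xi>. (norm (gradient w \<xi>))\<^sup>2 \<partial>lebesgue)"
  unfolding mean_square_displacement_def L2_norm_def by (simp add: integral_nonneg_AE)

text \<open>With \<open>r = x\<^sup>2 t\<^sup>\<alpha>\<close> and \<open>x = |\<xi>|\<close>, these turn the bounds for \<open>E\<close> and \<open>E'\<close> at \<open>r\<zeta>\<close> into powers of
  \<open>|\<xi>|\<close> times \<open>t\<close>; the factor \<open>x t\<^sup>\<alpha>\<close> in the second one comes from the chain rule.\<close>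

lemma powr_exponent_shift:
  fixes x t \<alpha> :: real
  assumes "0 < \<alpha>" "0 \<le> x" "0 < t"
  shows "(x\<^sup>2 * t powr \<alpha>) powr (1 / \<alpha>) = x powr (2 / \<alpha>) * t"
    and "(x\<^sup>2 * t powr \<alpha>) powr (1 / \<alpha> - 1) * (x * t powr \<alpha>) = x powr (2 / \<alpha> - 1) * t"
proof -
  have "x\<^sup>2 = x powr 2" using assms by simp
  then have x2: "x\<^sup>2 powr (1 / \<alpha>) = x powr (2 / \<alpha>)" by (simp only: powr_powr) simp
  show 1: "(x\<^sup>2 * t powr \<alpha>) powr (1 / \<alpha>) = x powr (2 / \<alpha>) * t"
    using assms x2 by (simp add: powr_mult powr_powr)
  show "(x\<^sup>2 * t powr \<alpha>) powr (1 / \<alpha> - 1) * (x * t powr \<alpha>) = x powr (2 / \<alpha> - 1) * t"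
  proof (cases "x = 0")
    case False
    then have "x > 0" using assms by simp
    then have A: "x\<^sup>2 * t powr \<alpha> > 0" using assms by simp
    have "(x\<^sup>2 * t powr \<alpha>) powr (1 / \<alpha> - 1) = x powr (2 / \<alpha>) * t / (x\<^sup>2 * t powr \<alpha>)"
      unfolding powr_diff 1 using A by simp
    moreover have "x powr (2 / \<alpha> - 1) = x powr (2 / \<alpha>) / x"
      unfolding powr_diff using \<open>x > 0\<close> by simp
    ultimately show ?thesis using \<open>x > 0\<close> assms by (simp add: power2_eq_square)
  qed simp
qed

text \<open>A lower bound, linear in the distance to the outer sphere, for the loss in the growth rate.\<close>

lemma powr_gap:
  assumes "0 \<le> x" "x \<le> (y::real)" "1 \<le> p"
  shows "y powr (p - 1) * (y - x) \<le> y powr p - x powr p"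
proof (cases "x = 0")
  case True
  then show ?thesis using assms by (cases "y = 0") (auto simp: powr_diff)
next
  case False
  then have x: "x > 0" "y > 0" using assms by auto
  have "x powr p = x powr (p - 1) * x" using x by (simp add: powr_diff)
  also have "\<dots> \<le> y powr (p - 1) * x" using assms x by (intro mult_right_mono powr_mono2) auto
  finally have "x powr p \<le> y powr (p - 1) * x" .
  moreover have "y powr p = y powr (p - 1) * y" using x by (simp add: powr_diff)
  ultimately show ?thesis by (simp add: right_diff_distrib)
qed

lemma square_exp_decay:
  assumes "0 < k" "0 < t" "0 \<le> (x::real)"
  shows "(t * x)\<^sup>2 * exp (- (k * x * t)) \<le> 2 / k\<^sup>2"
proof -
  have "(k * x * t)\<^sup>2 / 2 \<le> exp (k * x * t)"
  proof -
    have "0 \<le> k * x * t" using assms by simp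
    then show ?thesis using exp_lower_Taylor_quadratic[of "k * x * t"] by linarith
  qed
  then have "(k * x * t)\<^sup>2 * exp (- (k * x * t)) \<le> 2"
    by (simp add: exp_minus field_simps)
  then show ?thesis using assms by (simp add: field_simps power_mult_distrib)
qed

lemma continuous_gradient_radial_multiplier:
  fixes g :: "real^'d \<Rightarrow> complex"
  assumes E: "E holomorphic_on UNIV" and g: "\<And>\<xi>. g differentiable (at \<xi>)" "continuous_on UNIV (gradient g)"
  shows "continuous_on UNIV (gradient (\<lambda>\<eta>. E (\<zeta> * of_real ((norm \<eta>)\<^sup>2 * T)) * g \<eta>))"
proof -
  have E1: "continuous_on UNIV E" and E2: "continuous_on UNIV (deriv E)"
    using E holomorphic_deriv[OF E open_UNIV] by (auto intro: holomorphic_on_imp_continuous_on)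
  have g0: "continuous_on UNIV g"
    using g(1) by (simp add: continuous_on_eq_continuous_within differentiable_imp_continuous_within)
  show ?thesis
    unfolding gradient_radial_multiplier[OF E g(1), abs_def]
    by (intro continuous_on_add continuous_on_vec_lambda continuous_intros g0 g(2)
          continuous_on_compose2[OF E1] continuous_on_compose2[OF E2]) auto
qed

lemma polar_direction:
  fixes \<xi> :: "real^'d"
  obtains u :: "real^'d" where "norm u = 1" "\<xi> = norm \<xi> *\<^sub>R u"
proof (cases "\<xi> = 0")
  case True
  then show ?thesis using that[of "axis undefined 1"] by simp
next
  case False
  then show ?thesis using that[of "\<xi> /\<^sub>R norm \<xi>"] by simp
qed

text \<open>The function vanishes at points just outside the sphere on the same ray, and the
  Lipschitz bound carries this inwards.\<close>

lemma bound_by_distance_to_boundary: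
  fixes g :: "real^'d \<Rightarrow> complex"
  assumes lip: "\<And>\<xi> \<eta>. norm (g \<xi> - g \<eta>) \<le> M * norm (\<xi> - \<eta>)"
    and supp: "\<And>\<eta>. \<Lambda> < norm \<eta> \<Longrightarrow> g \<eta> = 0" and \<xi>: "norm \<xi> \<le> \<Lambda>"
  shows "norm (g \<xi>) \<le> M * (\<Lambda> - norm \<xi>)"
proof -
  obtain u :: "real^'d" where u: "norm u = 1" "\<xi> = norm \<xi> *\<^sub>R u"
    using polar_direction by blast
  have "norm (g \<xi>) \<le> M * (s - norm \<xi>)" if "\<Lambda> < s" for s
  proof -
    have "s \<ge> 0" using that \<xi> norm_ge_zero[of \<xi>] by linarith
    then have s: "norm (s *\<^sub>R u) = s" using u by simp
    have "norm (\<xi> - s *\<^sub>R u) = norm ((norm \<xi> - s) *\<^sub>R u)" using u(2) by (metis scaleR_left_diff_distrib)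
    also have "\<dots> = s - norm \<xi>" using u that \<xi> by simp
    finally show ?thesis using lip[of \<xi> "s *\<^sub>R u"] supp[of "s *\<^sub>R u"] s that by simp
  qed
  then have "\<forall>\<^sub>F s in at_right \<Lambda>. norm (g \<xi>) \<le> M * (s - norm \<xi>)"
    by (auto simp: eventually_at_right_less eventually_at_filter)
  moreover have "((\<lambda>s. M * (s - norm \<xi>)) \<longlongrightarrow> M * (\<Lambda> - norm \<xi>)) (at_right \<Lambda>)"
    by (intro tendsto_intros)
  ultimately show ?thesis
    using tendsto_lowerbound trivial_limit_at_right_real by blast
qed

text \<open>Pointwise, the squared gradient is at most a multiple of \<open>exp(2c|\<xi>|\<^sup>2\<^sup>/\<^sup>\<alpha>t)((t|g|)\<^sup>2 + 1)\<close>. With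
  \<open>x = \<Lambda> - |\<xi>|\<close>, the exponential is at most \<open>exp(2c\<Lambda>\<^sup>2\<^sup>/\<^sup>\<alpha>t) e\<^sup>-\<^sup>k\<^sup>x\<^sup>t\<close> and \<open>|g| \<le> M x\<close>. The vanishing of
  \<open>g\<close> at the sphere thus compensates the factor \<open>t\<^sup>2\<close> from differentiating the exponential, and a
  bound without any power of \<open>t\<close> results.\<close>

lemma displacement_upper_bound:
  fixes g :: "real^'d \<Rightarrow> complex"
  assumes \<alpha>: "0 < \<alpha>" "\<alpha> \<le> 1" and \<zeta>: "norm \<zeta> = 1" "\<bar>Arg \<zeta>\<bar> < pi * \<alpha> / 2"
    and g: "C_k 1 g" "compact (supp g)" and \<Lambda>: "0 < \<Lambda>" "supp g \<subseteq> cball 0 \<Lambda>"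
  defines "c \<equiv> cos (Arg \<zeta> / \<alpha>)"
    and "w \<equiv> \<lambda>t \<xi>. mittag_leffler \<alpha> 1 (\<zeta> * of_real ((norm \<xi>)\<^sup>2 * t powr \<alpha>)) * g \<xi>"
  obtains K where "K > 0" "\<And>t. 1 \<le> t \<Longrightarrow> integrable lebesgue (\<lambda>\<xi>. (norm (gradient (w t) \<xi>))\<^sup>2)"
    "\<And>t. 1 \<le> t \<Longrightarrow> mean_square_displacement (w t) \<le> K * exp (2 * c * \<Lambda> powr (2 / \<alpha>) * t)"
proof -
  let ?E = "mittag_leffler \<alpha> 1"
  have c: "c > 0" unfolding c_def by (rule cos_divide_pos[OF \<alpha>(1) \<zeta>(2)])
  obtain C where C: "C > 0"
    and E0: "\<And>r. 0 \<le> r \<Longrightarrow> norm (?E (of_real r * \<zeta>)) \<le> C * exp (c * r powr (1 / \<alpha>))"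
    and E1: "\<And>r. 0 \<le> r \<Longrightarrow> norm (deriv ?E (of_real r * \<zeta>)) \<le> C * (1 + r powr (1 / \<alpha> - 1)) * exp (c * r powr (1 / \<alpha>))"
    using mittag_leffler_ray_bounds[OF \<alpha> \<zeta>, folded c_def] by metis
  obtain M where M: "M > 0" "\<And>\<xi>. norm (gradient g \<xi>) \<le> M" "\<And>\<xi> \<eta>. norm (g \<xi> - g \<eta>) \<le> M * norm (\<xi> - \<eta>)"
    "continuous_on UNIV (gradient g)" "\<And>\<xi>. \<xi> \<notin> supp g \<Longrightarrow> gradient g \<xi> = 0"
    using C1_compact_support[OF g] by metis
  have g0: "g \<xi> = 0" if "\<xi> \<notin> supp g" for \<xi>
    using that closure_subset[of "{x. g x \<noteq> 0}"] by (auto simp: supp_def)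
  have hol: "?E holomorphic_on UNIV" by (rule mittag_leffler_holomorphic[OF \<alpha>(1)])
  have diff: "g differentiable (at \<xi>)" for \<xi> using g(1) by simp
  define p where "p = 2 / \<alpha>"
  have p: "p \<ge> 2" using \<alpha> by (simp add: p_def pos_le_divide_eq)
  define e where "e = (\<lambda>t \<xi>. exp (c * ((norm (\<xi>::real^'d)) powr p * t)))"
  define C1 where "C1 = 2 * C * (\<Lambda> + \<Lambda> powr (p - 1))"
  define k where "k = 2 * c * \<Lambda> powr (p - 1)"
  have k: "k > 0" using c \<Lambda> by (simp add: k_def)
  have C1: "C1 > 0" using C \<Lambda> by (simp add: C1_def add_pos_pos)
  have ptw: "norm (gradient (w t) \<xi>) \<le> e t \<xi> * (C1 * t * norm (g \<xi>) + C * M)" if t: "1 \<le> t" and \<xi>: "norm \<xi> \<le> \<Lambda>" for t \<xi>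
  proof -
    define r where "r = (norm \<xi>)\<^sup>2 * t powr \<alpha>"
    have r: "r \<ge> 0" "r powr (1 / \<alpha>) = norm \<xi> powr p * t" 
      "r powr (1 / \<alpha> - 1) * (norm \<xi> * t powr \<alpha>) = norm \<xi> powr (p - 1) * t"
      unfolding r_def p_def using powr_exponent_shift[OF \<alpha>(1) norm_ge_zero[of \<xi>], of t] t by auto
    have e: "exp (c * r powr (1 / \<alpha>)) = e t \<xi>" by (simp add: e_def r(2))
    have "norm (gradient (w t) \<xi>) \<le> norm (deriv ?E (of_real r * \<zeta>) * \<zeta> * of_real (2 * t powr \<alpha>) * g \<xi>) * norm \<xi> + norm (?E (of_real r * \<zeta>)) * norm (gradient g \<xi>)"
      unfolding w_def gradient_radial_multiplier[OF hol diff]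
      by (rule order_trans[OF norm_triangle_ineq])
         (simp only: norm_vec_of_real norm_vec_mult_left r_def mult.commute[of \<zeta> "of_real _"] norm_mult order_refl)
    also have "\<dots> = norm (deriv ?E (of_real r * \<zeta>)) * (norm \<xi> * t powr \<alpha>) * (2 * norm (g \<xi>)) + norm (?E (of_real r * \<zeta>)) * norm (gradient g \<xi>)"
      using \<zeta> by (simp add: norm_mult)
    also have "\<dots> \<le> (C * (1 + r powr (1 / \<alpha> - 1)) * e t \<xi>) * (norm \<xi> * t powr \<alpha>) * (2 * norm (g \<xi>)) + (C * e t \<xi>) * M"
      using E0[OF r(1)] E1[OF r(1)] M(2)[of \<xi>] C unfolding e
      by (intro add_mono mult_mono mult_right_mono) (auto simp: e_def)
    also have "(C * (1 + r powr (1 / \<alpha> - 1)) * e t \<xi>) * (norm \<xi> * t powr \<alpha>) = C * e t \<xi> * (norm \<xi> * t powr \<alpha> + r powr (1 / \<alpha> - 1) * (norm \<xi> * t powr \<alpha>))"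
      by (simp add: algebra_simps)
    also have "\<dots> \<le> C * e t \<xi> * ((\<Lambda> + \<Lambda> powr (p - 1)) * t)"
    proof (intro mult_left_mono)
      have "t powr \<alpha> \<le> t powr 1" using t \<alpha> by (intro powr_mono) auto
      then have "norm \<xi> * t powr \<alpha> \<le> \<Lambda> * t" using \<xi> t \<Lambda> by (intro mult_mono) auto
      moreover have "norm \<xi> powr (p - 1) * t \<le> \<Lambda> powr (p - 1) * t"
        using \<xi> t p by (intro mult_right_mono powr_mono2) auto
      ultimately show "norm \<xi> * t powr \<alpha> + r powr (1 / \<alpha> - 1) * (norm \<xi> * t powr \<alpha>) \<le> (\<Lambda> + \<Lambda> powr (p - 1)) * t"
        unfolding r(3) by (simp add: distrib_right)
    qed (use C in \<open>simp add: e_def\<close>)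
    finally have "norm (gradient (w t) \<xi>) \<le> C * e t \<xi> * ((\<Lambda> + \<Lambda> powr (p - 1)) * t) * (2 * norm (g \<xi>)) + (C * e t \<xi>) * M"
      by (simp add: mult_right_mono)
    also have "\<dots> = e t \<xi> * (C1 * t * norm (g \<xi>) + C * M)" by (simp add: C1_def algebra_simps)
    finally show ?thesis .
  qed
  define K1 where "K1 = 2 * (C1\<^sup>2 * M\<^sup>2 * (2 / k\<^sup>2)) + 2 * (C * M)\<^sup>2"
  have K1: "K1 > 0" using C1 M k C by (auto simp: K1_def intro!: add_nonneg_pos)
  let ?G = "\<lambda>t. exp (2 * c * \<Lambda> powr p * t)"
  have sq: "(norm (gradient (w t) \<xi>))\<^sup>2 \<le> K1 * ?G t * indicator (cball 0 \<Lambda>) \<xi>" if t: "1 \<le> t" for t \<xi>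
  proof (cases "norm \<xi> \<le> \<Lambda>")
    case False
    then have "\<xi> \<notin> supp g" using \<Lambda> by auto
    then have "gradient (w t) \<xi> = 0"
      unfolding w_def gradient_radial_multiplier[OF hol diff] using M(5) g0 by (simp add: vec_eq_iff)
    then show ?thesis using K1 by simp
  next
    case True
    define x where "x = \<Lambda> - norm \<xi>"
    have x: "x \<ge> 0" using True by (simp add: x_def)
    have gx: "norm (g \<xi>) \<le> M * x" unfolding x_def
      using \<Lambda> by (intro bound_by_distance_to_boundary[OF M(3) g0 True]) auto
    have e2: "(e t \<xi>)\<^sup>2 = exp (2 * c * norm \<xi> powr p * t)"
      by (simp add: e_def power2_eq_square algebra_simps flip: exp_add)
    have "k * x \<le> 2 * c * (\<Lambda> powr p - norm \<xi> powr p)"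
      using powr_gap[of "norm \<xi>" \<Lambda> p] True p c by (simp add: k_def x_def mult.assoc)
    then have "k * x * t \<le> 2 * c * (\<Lambda> powr p - norm \<xi> powr p) * t" using t by (intro mult_right_mono) auto
    then have "2 * c * norm \<xi> powr p * t \<le> 2 * c * \<Lambda> powr p * t + - (k * x * t)" by (simp add: algebra_simps)
    then have e3: "(e t \<xi>)\<^sup>2 \<le> ?G t * exp (- (k * x * t))"
      unfolding e2 exp_add[symmetric] by simp
    have e4: "(e t \<xi>)\<^sup>2 \<le> ?G t * 1"
    proof (rule order_trans[OF e3 mult_left_mono])
      show "exp (- (k * x * t)) \<le> 1" using k x t by simp
    qed simp
    have "(norm (gradient (w t) \<xi>))\<^sup>2 \<le> (e t \<xi> * (C1 * t * norm (g \<xi>) + C * M))\<^sup>2"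
      using ptw[OF t True] by (intro power_mono) auto
    also have "\<dots> = (e t \<xi>)\<^sup>2 * (C1 * t * norm (g \<xi>) + C * M)\<^sup>2" by (rule power_mult_distrib)
    also have "\<dots> \<le> (e t \<xi>)\<^sup>2 * (2 * (C1 * t * norm (g \<xi>))\<^sup>2 + 2 * (C * M)\<^sup>2)"
      by (intro mult_left_mono) (use sum_squares_bound[of "C1 * t * norm (g \<xi>)" "C * M"] in \<open>auto simp: power2_sum\<close>)
    also have "\<dots> \<le> (e t \<xi>)\<^sup>2 * (2 * (C1 * t * (M * x))\<^sup>2 + 2 * (C * M)\<^sup>2)"
      using gx C1 C M(1) t by (intro mult_left_mono add_mono power_mono) auto
    also have "\<dots> = 2 * (C1\<^sup>2 * M\<^sup>2) * ((t * x)\<^sup>2 * (e t \<xi>)\<^sup>2) + 2 * (C * M)\<^sup>2 * (e t \<xi>)\<^sup>2"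
      by (simp add: algebra_simps power_mult_distrib)
    also have "\<dots> \<le> 2 * (C1\<^sup>2 * M\<^sup>2) * (?G t * (2 / k\<^sup>2)) + 2 * (C * M)\<^sup>2 * (?G t * 1)"
    proof (intro add_mono mult_left_mono e4)
      have "(t * x)\<^sup>2 * (e t \<xi>)\<^sup>2 \<le> (t * x)\<^sup>2 * (?G t * exp (- (k * x * t)))" by (intro mult_left_mono e3) auto
      also have "\<dots> = ?G t * ((t * x)\<^sup>2 * exp (- (k * x * t)))" by simp
      also have "\<dots> \<le> ?G t * (2 / k\<^sup>2)" using square_exp_decay[OF k, of t x] t x by (intro mult_left_mono) auto
      finally show "(t * x)\<^sup>2 * (e t \<xi>)\<^sup>2 \<le> ?G t * (2 / k\<^sup>2)" .
    qed auto
    also have "\<dots> = K1 * ?G t" by (simp add: K1_def algebra_simps)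
    finally show ?thesis using True by simp
  qed
  have ind: "integrable lebesgue (\<lambda>\<xi>::real^'d. K1 * ?G t * indicator (cball 0 \<Lambda>) \<xi>)" for t
    using emeasure_lborel_cball_finite[of "0::real^'d" \<Lambda>]
    by (intro integrable_mult_right integrable_real_indicator) (auto simp: emeasure_completion)
  have int: "integrable lebesgue (\<lambda>\<xi>. (norm (gradient (w t) \<xi>))\<^sup>2)" if t: "1 \<le> t" for t
  proof (rule Bochner_Integration.integrable_bound[OF ind[of t]])
    have "continuous_on UNIV (\<lambda>\<xi>. (norm (gradient (w t) \<xi>))\<^sup>2)"
      unfolding w_def by (intro continuous_intros continuous_gradient_radial_multiplier hol diff M(4))
    then show "(\<lambda>\<xi>. (norm (gradient (w t) \<xi>))\<^sup>2) \<in> borel_measurable lebesgue"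
      by (intro measurable_completion) (simp add: borel_measurable_continuous_onI)
    show "AE \<xi> in lebesgue. norm ((norm (gradient (w t) \<xi>))\<^sup>2) \<le> norm (K1 * ?G t * indicator (cball 0 \<Lambda>) \<xi>)"
      using sq[OF t] K1 by (intro AE_I2) (simp add: abs_mult)
  qed
  show ?thesis
  proof (rule that[of "K1 * measure lebesgue (cball (0::real^'d) \<Lambda>)"])
    show "K1 * measure lebesgue (cball (0::real^'d) \<Lambda>) > 0"
      using K1 content_cball_pos[of \<Lambda> "0::real^'d"] \<Lambda> by simp
    fix t :: real assume t: "1 \<le> t"
    show "integrable lebesgue (\<lambda>\<xi>. (norm (gradient (w t) \<xi>))\<^sup>2)" by (rule int[OF t])
    have "mean_square_displacement (w t) \<le> (\<integral>\<xi>. K1 * ?G t * indicator (cball 0 \<Lambda>) (\<xi>::real^'d) \<partial>lebesgue)"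
      unfolding mean_square_displacement_eq by (intro integral_mono int[OF t] ind sq[OF t])
    also have "\<dots> = K1 * measure lebesgue (cball (0::real^'d) \<Lambda>) * ?G t" by simp
    finally show "mean_square_displacement (w t) \<le> K1 * measure lebesgue (cball (0::real^'d) \<Lambda>) * exp (2 * c * \<Lambda> powr (2 / \<alpha>) * t)"
      by (simp add: p_def)
  qed
qed

section \<open>The lower bound and the theorem\<close>

text \<open>Near \<open>\<xi>0\<close> the derivative of \<open>E\<close> contributes to the gradient a term of size \<open>t exp(c|\<xi>|\<^sup>2\<^sup>/\<^sup>\<alpha>t)\<close>,
  which for large \<open>t\<close> outweighs the term of size \<open>exp(c|\<xi>|\<^sup>2\<^sup>/\<^sup>\<alpha>t)\<close> from the gradient of \<open>g\<close>.
  Integrating over a small ball suffices.\<close>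

lemma displacement_lower_bound:
  fixes g :: "real^'d \<Rightarrow> complex"
  assumes \<alpha>: "0 < \<alpha>" "\<alpha> \<le> 1" and \<zeta>: "norm \<zeta> = 1" "\<bar>Arg \<zeta>\<bar> < pi * \<alpha> / 2"
    and g: "C_k 1 g" "compact (supp g)" and \<xi>0: "g \<xi>0 \<noteq> 0" and \<rho>: "0 < \<rho>" "\<rho> < norm \<xi>0"
  defines "c \<equiv> cos (Arg \<zeta> / \<alpha>)"
    and "w \<equiv> \<lambda>t \<xi>. mittag_leffler \<alpha> 1 (\<zeta> * of_real ((norm \<xi>)\<^sup>2 * t powr \<alpha>)) * g \<xi>"
  assumes int: "\<And>t. 1 \<le> t \<Longrightarrow> integrable lebesgue (\<lambda>\<xi>. (norm (gradient (w t) \<xi>))\<^sup>2)"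
  obtains V where "V > 0"
    "\<forall>\<^sub>F t in at_top. V * exp (2 * c * \<rho> powr (2 / \<alpha>) * t) \<le> mean_square_displacement (w t)"
proof -
  let ?E = "mittag_leffler \<alpha> 1"
  have c: "c > 0" unfolding c_def by (rule cos_divide_pos[OF \<alpha>(1) \<zeta>(2)])
  obtain C k R where C: "C > 0" "k > 0"
    and E0: "\<And>r. 0 \<le> r \<Longrightarrow> norm (?E (of_real r * \<zeta>)) \<le> C * exp (c * r powr (1 / \<alpha>))"
    and E1: "\<And>r. R \<le> r \<Longrightarrow> k * r powr (1 / \<alpha> - 1) * exp (c * r powr (1 / \<alpha>)) \<le> norm (deriv ?E (of_real r * \<zeta>))"
    using mittag_leffler_ray_bounds[OF \<alpha> \<zeta>, folded c_def] by metis
  obtain M where M: "M > 0" "\<And>\<xi>. norm (gradient g \<xi>) \<le> M"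
    using C1_compact_support[OF g] by metis
  have hol: "?E holomorphic_on UNIV" by (rule mittag_leffler_holomorphic[OF \<alpha>(1)])
  have diff: "g differentiable (at \<xi>)" for \<xi> using g(1) by simp
  define p where "p = 2 / \<alpha>"
  have p: "p \<ge> 2" using \<alpha> by (simp add: p_def pos_le_divide_eq)
  define m where "m = norm (g \<xi>0) / 2"
  have m: "m > 0" using \<xi>0 by (simp add: m_def)
  obtain \<epsilon> where \<epsilon>: "\<epsilon> > 0" and ball: "\<And>\<xi>. \<xi> \<in> ball \<xi>0 \<epsilon> \<Longrightarrow> m \<le> norm (g \<xi>) \<and> \<rho> \<le> norm \<xi>"
  proof -
    have "isCont (\<lambda>\<xi>. norm (g \<xi>)) \<xi>0" "isCont norm \<xi>0"
      using differentiable_imp_continuous_within[OF diff] by (auto intro!: continuous_intros)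
    then have lim: "((\<lambda>\<xi>. norm (g \<xi>)) \<longlongrightarrow> norm (g \<xi>0)) (nhds \<xi>0)" "(norm \<longlongrightarrow> norm \<xi>0) (nhds \<xi>0)"
      using tendsto_at_iff_tendsto_nhds[of "\<lambda>\<xi>. norm (g \<xi>)" \<xi>0] tendsto_at_iff_tendsto_nhds[of norm \<xi>0]
      unfolding isCont_def by blast+
    have "m < norm (g \<xi>0)" using \<xi>0 by (simp add: m_def)
    from order_tendstoD(1)[OF lim(1) this] order_tendstoD(1)[OF lim(2) \<rho>(2)]
    have "\<forall>\<^sub>F \<xi> in nhds \<xi>0. m < norm (g \<xi>) \<and> \<rho> < norm \<xi>" by (rule eventually_conj)
    then obtain d where "d > 0" "\<And>\<xi>. dist \<xi> \<xi>0 < d \<Longrightarrow> m < norm (g \<xi>) \<and> \<rho> < norm \<xi>"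
      unfolding eventually_nhds_metric by blast
    then show ?thesis by (intro that[of d]) (auto simp: dist_commute less_imp_le)
  qed
  have ptw: "exp (c * (\<rho> powr p * t)) \<le> norm (gradient (w t) \<xi>)"
    if \<xi>: "\<xi> \<in> ball \<xi>0 \<epsilon>" and t: "0 < t" "R \<le> \<rho>\<^sup>2 * t powr \<alpha>" "1 + C * M \<le> 2 * k * m * \<rho> powr (p - 1) * t" for t \<xi>
  proof -
    have n\<xi>: "\<rho> \<le> norm \<xi>" "m \<le> norm (g \<xi>)" using ball[OF \<xi>] by auto
    define r where "r = (norm \<xi>)\<^sup>2 * t powr \<alpha>"
    have r: "r \<ge> 0" "r powr (1 / \<alpha>) = norm \<xi> powr p * t" 
      "r powr (1 / \<alpha> - 1) * (norm \<xi> * t powr \<alpha>) = norm \<xi> powr (p - 1) * t"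
      unfolding r_def p_def using powr_exponent_shift[OF \<alpha>(1) norm_ge_zero[of \<xi>], of t] t by auto
    have "\<rho>\<^sup>2 * t powr \<alpha> \<le> r" unfolding r_def using n\<xi> \<rho> by (intro mult_right_mono power_mono) auto
    then have rR: "R \<le> r" using t by simp
    let ?e = "exp (c * (norm \<xi> powr p * t))"
    let ?A = "\<chi> j. (deriv ?E (of_real r * \<zeta>) * \<zeta> * of_real (2 * t powr \<alpha>) * g \<xi>) * of_real (\<xi> $ j)"
    let ?B = "\<chi> j. ?E (of_real r * \<zeta>) * gradient g \<xi> $ j"
    have "gradient (w t) \<xi> = ?A + ?B"
      unfolding w_def gradient_radial_multiplier[OF hol diff] r_def by (simp only: mult.commute[of \<zeta> "of_real _"])
    moreover have "norm ?A = norm (deriv ?E (of_real r * \<zeta>)) * (norm \<xi> * t powr \<alpha>) * (2 * norm (g \<xi>))"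
      unfolding norm_vec_of_real using \<zeta> by (simp add: norm_mult)
    moreover have "norm ?B = norm (?E (of_real r * \<zeta>)) * norm (gradient g \<xi>)" by (rule norm_vec_mult_left)
    moreover have "norm (?A + ?B) \<ge> norm ?A - norm ?B" using norm_triangle_ineq4[of "?A + ?B" ?B] by simp
    ultimately have "norm (deriv ?E (of_real r * \<zeta>)) * (norm \<xi> * t powr \<alpha>) * (2 * norm (g \<xi>))
        - norm (?E (of_real r * \<zeta>)) * norm (gradient g \<xi>) \<le> norm (gradient (w t) \<xi>)" by (simp only:)
    moreover have "norm (?E (of_real r * \<zeta>)) * norm (gradient g \<xi>) \<le> (C * ?e) * M"
      using E0[OF r(1)] M(2)[of \<xi>] C unfolding r(2) by (intro mult_mono) auto
    moreover have "(k * r powr (1 / \<alpha> - 1) * ?e) * (norm \<xi> * t powr \<alpha>) * (2 * m)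
       \<le> norm (deriv ?E (of_real r * \<zeta>)) * (norm \<xi> * t powr \<alpha>) * (2 * norm (g \<xi>))"
      using E1[OF rR] n\<xi> C m unfolding r(2) by (intro mult_mono) auto
    moreover have "(k * r powr (1 / \<alpha> - 1) * ?e) * (norm \<xi> * t powr \<alpha>) * (2 * m)
       = ?e * (2 * k * m * (norm \<xi> powr (p - 1) * t))"
      unfolding r(3)[symmetric] by (simp add: algebra_simps)
    moreover have "?e * (1 + C * M) \<le> ?e * (2 * k * m * (norm \<xi> powr (p - 1) * t))"
    proof (rule mult_left_mono)
      have "2 * k * m * (\<rho> powr (p - 1) * t) \<le> 2 * k * m * (norm \<xi> powr (p - 1) * t)"
        using C m n\<xi> \<rho> p t by (intro mult_left_mono mult_right_mono powr_mono2) auto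
      then show "1 + C * M \<le> 2 * k * m * (norm \<xi> powr (p - 1) * t)" using t(3) by (simp add: mult.assoc)
    qed simp
    moreover have "?e * (1 + C * M) = ?e + (C * ?e) * M" by (simp add: algebra_simps)
    ultimately have "?e \<le> norm (gradient (w t) \<xi>)" by linarith
    moreover have "exp (c * (\<rho> powr p * t)) \<le> ?e"
    proof -
      have "c * (\<rho> powr p * t) \<le> c * (norm \<xi> powr p * t)"
        using n\<xi> \<rho> p t c by (intro mult_left_mono mult_right_mono powr_mono2) auto
      then show ?thesis by simp
    qed
    ultimately show ?thesis by linarith
  qed
  have ind: "integrable lebesgue (\<lambda>\<xi>. a * indicator (ball \<xi>0 \<epsilon>) \<xi> :: real)" for a
    using emeasure_lborel_ball_finite[of \<xi>0 \<epsilon>]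
    by (intro integrable_mult_right integrable_real_indicator) (auto simp: emeasure_completion)
  show ?thesis
  proof (rule that[of "measure lebesgue (ball \<xi>0 \<epsilon>)"])
    show "measure lebesgue (ball \<xi>0 \<epsilon>) > 0" using content_ball_pos[OF \<epsilon>, of \<xi>0] by simp
    have "\<forall>\<^sub>F t in at_top. R \<le> \<rho>\<^sup>2 * t powr \<alpha>" using \<rho> \<alpha> by real_asymp
    moreover have "\<forall>\<^sub>F t in at_top. 1 + C * M \<le> 2 * k * m * \<rho> powr (p - 1) * t"
    proof -
      have "2 * k * m * \<rho> powr (p - 1) > 0" using C m \<rho> by simp
      then show ?thesis by real_asymp
    qed
    ultimately show "\<forall>\<^sub>F t in at_top. measure lebesgue (ball \<xi>0 \<epsilon>) * exp (2 * c * \<rho> powr (2 / \<alpha>) * t) \<le> mean_square_displacement (w t)"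
      using eventually_ge_at_top[of 1]
    proof eventually_elim
      case (elim t)
      let ?X = "exp (c * (\<rho> powr p * t))"
      have "(\<integral>\<xi>. ?X\<^sup>2 * indicator (ball \<xi>0 \<epsilon>) \<xi> \<partial>lebesgue) \<le> mean_square_displacement (w t)"
        unfolding mean_square_displacement_eq
      proof (intro integral_mono ind int[OF elim(3)])
        fix \<xi>
        have "?X\<^sup>2 \<le> (norm (gradient (w t) \<xi>))\<^sup>2" if "\<xi> \<in> ball \<xi>0 \<epsilon>"
          using ptw[OF that _ elim(1,2)] elim(3) by (intro power_mono) auto
        then show "?X\<^sup>2 * indicator (ball \<xi>0 \<epsilon>) \<xi> \<le> (norm (gradient (w t) \<xi>))\<^sup>2"
          by (auto simp: indicator_def)
      qed
      moreover have "?X\<^sup>2 = exp (2 * c * \<rho> powr (2 / \<alpha>) * t)"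
        by (simp add: power2_eq_square p_def algebra_simps flip: exp_add)
      ultimately show ?case by (simp add: mult.commute)
    qed
  qed
qed

text \<open>The set where \<open>g\<close> is nonzero is open, so a point of it on the inner sphere can be pushed
  outwards.\<close>

lemma support_point_beyond_inner_radius:
  fixes g :: "real^'d \<Rightarrow> complex"
  assumes cont: "continuous_on UNIV g" and \<Lambda>: "0 \<le> \<Lambda>" "\<And>\<xi>. g \<xi> \<noteq> 0 \<Longrightarrow> \<Lambda> \<le> norm \<xi>" and g: "g \<xi>1 \<noteq> 0"
  obtains \<xi>0 where "g \<xi>0 \<noteq> 0" "\<Lambda> < norm \<xi>0"
proof -
  obtain u :: "real^'d" where u: "norm u = 1" "\<xi>1 = norm \<xi>1 *\<^sub>R u"
    using polar_direction by blast
  have "continuous_on UNIV (\<lambda>h. g (\<xi>1 + h *\<^sub>R u))"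
    by (intro continuous_on_compose2[OF cont] continuous_intros) auto
  then have "((\<lambda>h. g (\<xi>1 + h *\<^sub>R u)) \<longlongrightarrow> g (\<xi>1 + 0 *\<^sub>R u)) (at 0 within UNIV)"
    unfolding continuous_on_def by blast
  from tendsto_within_subset[OF this subset_UNIV]
  have "((\<lambda>h. g (\<xi>1 + h *\<^sub>R u)) \<longlongrightarrow> g \<xi>1) (at_right 0)" by simp
  then have "\<forall>\<^sub>F h in at_right 0. g (\<xi>1 + h *\<^sub>R u) \<noteq> 0" using g by (rule tendsto_imp_eventually_ne)
  then obtain b where "b > 0" and b: "\<And>h. 0 < h \<Longrightarrow> h < b \<Longrightarrow> g (\<xi>1 + h *\<^sub>R u) \<noteq> 0"
    unfolding eventually_at_right_field by auto
  show ?thesis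
  proof (rule that)
    show "g (\<xi>1 + (b / 2) *\<^sub>R u) \<noteq> 0" using b[of "b / 2"] \<open>b > 0\<close> by simp
    have "\<xi>1 + (b / 2) *\<^sub>R u = (norm \<xi>1 + b / 2) *\<^sub>R u" using u(2) by (metis scaleR_left_distrib)
    then have "norm (\<xi>1 + (b / 2) *\<^sub>R u) = norm \<xi>1 + b / 2" using u(1) \<open>b > 0\<close> by simp
    then show "\<Lambda> < norm (\<xi>1 + (b / 2) *\<^sub>R u)" using \<Lambda>(2)[OF g] \<open>b > 0\<close> by simp
  qed
qed

theorem mainTheorem3:
  fixes u0 u0hat :: "real^'d \<Rightarrow> complex"
    and u uhat :: "real \<Rightarrow> real^'d \<Rightarrow> complex"
    and \<alpha> \<beta> \<Lambda>m \<Lambda>p :: real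
  assumes "0 < \<beta>" and "\<beta> < \<alpha>" and "\<alpha> \<le> 1"
    and "square_integrable u0"
    and "has_fourier_transform u0 u0hat"
    and "C_k 1 u0hat" and "compact (supp u0hat)"
    and "0 \<le> \<Lambda>m" and "\<Lambda>m \<le> \<Lambda>p"
    and "supp u0hat \<subseteq> {\<xi>. \<Lambda>m \<le> norm \<xi> \<and> norm \<xi> \<le> \<Lambda>p}"
    and "schroedinger_solution \<alpha> \<beta> u0 u"
    and "\<And>t. t > 0 \<Longrightarrow> has_fourier_transform (u t) (uhat t)"
    and "\<And>t \<xi>. t > 0 \<Longrightarrow> uhat t \<xi> =
           mittag_leffler \<alpha> 1 ((-\<i>) powr of_real \<beta> * of_real ((norm \<xi>)\<^sup>2 * t powr \<alpha>)) * u0hat \<xi>"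
  shows "\<exists>Rm Rp :: real \<Rightarrow> real.
           Rm \<in> O[at_top](\<lambda>t. 1 / t) \<and> Rp \<in> O[at_top](\<lambda>t. 1 / t) \<and>
           (\<forall>\<^sub>F t in at_top.
              4 / \<alpha>\<^sup>2 * exp (2 * cos (pi * \<beta> / (2 * \<alpha>)) * \<Lambda>m powr (2 / \<alpha>) * t) * t *
                ((L2_norm (\<lambda>\<xi>. of_real (norm \<xi> powr ((2 - \<alpha>) / \<alpha>)) * u0hat \<xi>))\<^sup>2 + Rm t)
                \<le> mean_square_displacement (uhat t) \<and>
              mean_square_displacement (uhat t) \<le>
              4 / \<alpha>\<^sup>2 * exp (2 * cos (pi * \<beta> / (2 * \<alpha>)) * \<Lambda>p powr (2 / \<alpha>) * t) * t *
                ((L2_norm (\<lambda>\<xi>. of_real (norm \<xi> powr ((2 - \<alpha>) / \<alpha>)) * u0hat \<xi>))\<^sup>2 + Rp t))"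
proof -
  let ?N = "(L2_norm (\<lambda>\<xi>. of_real (norm \<xi> powr ((2 - \<alpha>) / \<alpha>)) * u0hat \<xi>))\<^sup>2"
  define \<zeta> where "\<zeta> = (-\<i>) powr of_real \<beta>"
  define w where "w = (\<lambda>t \<xi>. mittag_leffler \<alpha> 1 (\<zeta> * of_real ((norm \<xi>)\<^sup>2 * t powr \<alpha>)) * u0hat \<xi>)"
  have w_eq: "(\<lambda>\<xi>. mittag_leffler \<alpha> 1 (\<zeta> * of_real ((norm \<xi>)\<^sup>2 * t powr \<alpha>)) * u0hat \<xi>) = w t" for t
    by (simp add: w_def)
  have uhat: "uhat t = w t" if "t > 0" for t
    using assms(13)[OF that] by (simp add: w_def \<zeta>_def fun_eq_iff)
  have \<alpha>: "0 < \<alpha>" "\<alpha> \<le> 1" using assms by auto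
  have g: "C_k 1 u0hat" "compact (supp u0hat)" by fact+
  have \<zeta>_cis: "\<zeta> = cis (- (pi * \<beta> / 2))"
    unfolding \<zeta>_def by (subst powr_polar) (auto simp: mult.commute)
  have \<beta>_pi: "pi * \<beta> < pi * \<alpha>" "pi * \<alpha> \<le> pi" "0 < pi * \<beta>" using assms by auto
  have Arg: "Arg \<zeta> = - (pi * \<beta> / 2)"
  proof -
    have "- pi < - (pi * \<beta> / 2)" "- (pi * \<beta> / 2) \<le> pi" using \<beta>_pi by linarith+
    then show ?thesis unfolding \<zeta>_cis by (intro Arg_cis) simp
  qed
  have \<zeta>: "norm \<zeta> = 1" "\<bar>Arg \<zeta>\<bar> < pi * \<alpha> / 2"
    using \<beta>_pi unfolding Arg by (auto simp: \<zeta>_cis)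
  have c: "cos (Arg \<zeta> / \<alpha>) = cos (pi * \<beta> / (2 * \<alpha>))"
    unfolding Arg by (simp add: mult.commute)
  have c_pos: "0 < cos (pi * \<beta> / (2 * \<alpha>))"
  proof -
    have "pi * \<beta> / (2 * \<alpha>) < pi / 2" using \<beta>_pi \<alpha> by (simp add: field_simps)
    moreover have "0 < pi * \<beta> / (2 * \<alpha>)" using \<beta>_pi \<alpha> by simp
    ultimately show ?thesis by (intro cos_gt_zero_pi) linarith+
  qed
  let ?c = "cos (pi * \<beta> / (2 * \<alpha>))"
  have supp: "\<Lambda>m \<le> norm \<xi> \<and> norm \<xi> \<le> \<Lambda>p" if "u0hat \<xi> \<noteq> 0" for \<xi>
    using that assms(10) closure_subset[of "{x. u0hat x \<noteq> 0}"] unfolding supp_def by blast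
  show ?thesis
  proof (cases "\<exists>\<xi>. u0hat \<xi> \<noteq> 0")
    case False
    then have "u0hat = (\<lambda>_. 0)" by auto
    then have "mean_square_displacement (uhat t) = 0" if "t > 0" for t
      unfolding uhat[OF that] w_def mean_square_displacement_eq
      by (simp add: gradient_def dir_deriv_def frechet_derivative_const zero_vec_def[symmetric])
    moreover have "?N = 0" unfolding \<open>u0hat = (\<lambda>_. 0)\<close> by (simp add: L2_norm_def)
    ultimately show ?thesis
      by (intro exI[of _ "\<lambda>_. 0"]) (auto intro: eventually_mono[OF eventually_gt_at_top[of 0]])
  next
    case True
    then obtain \<xi>1 where "u0hat \<xi>1 \<noteq> 0" by blast
    moreover have "continuous_on UNIV u0hat"
      using g(1) by (auto simp: continuous_on_eq_continuous_within intro: differentiable_imp_continuous_within)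
    ultimately obtain \<xi>0 where \<xi>0: "u0hat \<xi>0 \<noteq> 0" "\<Lambda>m < norm \<xi>0"
      using support_point_beyond_inner_radius[of u0hat \<Lambda>m] supp assms(8) by metis
    \<comment> \<open>any radius strictly between \<open>\<Lambda>m\<close> and \<open>norm \<xi>0\<close> would do\<close>
    define \<rho> where "\<rho> = (\<Lambda>m + norm \<xi>0) / 2"
    have \<rho>: "\<Lambda>m < \<rho>" "0 < \<rho>" "\<rho> < norm \<xi>0" using \<xi>0 assms(8) by (auto simp: \<rho>_def)
    have \<Lambda>p: "0 < \<Lambda>p" "supp u0hat \<subseteq> cball 0 \<Lambda>p"
      using supp[OF \<xi>0(1)] \<xi>0(2) assms(8,10) by auto
    obtain K where K: "K > 0" "\<And>t. 1 \<le> t \<Longrightarrow> integrable lebesgue (\<lambda>\<xi>. (norm (gradient (w t) \<xi>))\<^sup>2)"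
      "\<And>t. 1 \<le> t \<Longrightarrow> mean_square_displacement (w t) \<le> K * exp (2 * ?c * \<Lambda>p powr (2 / \<alpha>) * t)"
      by (rule displacement_upper_bound[OF \<alpha> \<zeta> g \<Lambda>p, unfolded w_eq c]) (rule that)
    obtain V where V: "V > 0"
      "\<forall>\<^sub>F t in at_top. V * exp (2 * ?c * \<rho> powr (2 / \<alpha>) * t) \<le> mean_square_displacement (w t)"
      by (rule displacement_lower_bound[OF \<alpha> \<zeta> g \<xi>0(1) \<rho>(2,3), unfolded w_eq c, OF K(2)]) (assumption, rule that)
    have "\<Lambda>m powr (2 / \<alpha>) < \<rho> powr (2 / \<alpha>)" using \<rho> \<alpha> assms(8) by (intro powr_less_mono2) auto
    then have gap: "0 < 2 * ?c * (\<rho> powr (2 / \<alpha>) - \<Lambda>m powr (2 / \<alpha>))" using c_pos by simp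
    have lower: "\<forall>\<^sub>F t in at_top. 4 / \<alpha>\<^sup>2 * exp (2 * ?c * \<Lambda>m powr (2 / \<alpha>) * t) * t * ?N
        \<le> V * exp (2 * ?c * \<rho> powr (2 / \<alpha>) * t)"
    proof -
      define d where "d = 2 * ?c * (\<rho> powr (2 / \<alpha>) - \<Lambda>m powr (2 / \<alpha>))"
      define A where "A = 4 / \<alpha>\<^sup>2 * ?N"
      have "d > 0" using gap by (simp add: d_def)
      then have "((\<lambda>t. A * t / exp (d * t)) \<longlongrightarrow> 0) at_top" by real_asymp
      then have "\<forall>\<^sub>F t in at_top. A * t / exp (d * t) < V" using V(1) by (rule order_tendstoD(2))
      then show ?thesis
      proof eventually_elim
        case (elim t)
        then have "A * t \<le> V * exp (d * t)" by (simp add: field_simps)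
        then have "exp (2 * ?c * \<Lambda>m powr (2 / \<alpha>) * t) * (A * t) \<le> exp (2 * ?c * \<Lambda>m powr (2 / \<alpha>) * t) * (V * exp (d * t))"
          by (intro mult_left_mono) auto
        also have "\<dots> = V * exp (2 * ?c * \<Lambda>m powr (2 / \<alpha>) * t + d * t)" by (simp add: exp_add)
        also have "2 * ?c * \<Lambda>m powr (2 / \<alpha>) * t + d * t = 2 * ?c * \<rho> powr (2 / \<alpha>) * t"
          by (simp add: d_def algebra_simps)
        finally show ?case by (simp add: A_def mult_ac)
      qed
    qed
    \<comment> \<open>chosen so that the remainder term alone equals the upper bound \<open>K exp(...)\<close>\<close>
    let ?Rp = "\<lambda>t. \<alpha>\<^sup>2 / 4 * K * (1 / t)"
    have "?Rp \<in> O[at_top](\<lambda>t. 1 / t)" using \<alpha> K(1) by (intro landau_o.big.cmult_in_iff[THEN iffD2]) auto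
    moreover have "\<forall>\<^sub>F t in at_top.
              4 / \<alpha>\<^sup>2 * exp (2 * ?c * \<Lambda>m powr (2 / \<alpha>) * t) * t * (?N + 0)
                \<le> mean_square_displacement (uhat t) \<and>
              mean_square_displacement (uhat t) \<le>
              4 / \<alpha>\<^sup>2 * exp (2 * ?c * \<Lambda>p powr (2 / \<alpha>) * t) * t * (?N + ?Rp t)"
      using lower V(2) eventually_ge_at_top[of 1]
    proof eventually_elim
      case (elim t)
      let ?X = "exp (2 * ?c * \<Lambda>p powr (2 / \<alpha>) * t)"
      have t: "t > 0" using elim by simp
      have "mean_square_displacement (w t) \<le> K * ?X" by (rule K(3)[OF elim(3)])
      also have "K * ?X = 4 / \<alpha>\<^sup>2 * ?X * t * ?Rp t" using \<alpha> t by (simp add: field_simps)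
      also have "\<dots> \<le> 4 / \<alpha>\<^sup>2 * ?X * t * (?N + ?Rp t)" using t by (intro mult_left_mono) auto
      finally show ?case using order_trans[OF elim(1,2)] unfolding uhat[OF t] add_0_right by (rule conjI[rotated])
    qed
    ultimately show ?thesis by (intro exI[of _ "\<lambda>_. 0"] exI[of _ ?Rp]) simp
  qed
qed

end
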